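(* Let $0<\alpha<\frac12$. The flow $\Phi_t(\cdot,\xi)$ on $X^\alpha$ of the stochastic damped cubic beam equation on $\mathbb T^3$ does not satisfy the strong Feller property: for every $t>0$ there exists a bounded measurable function $G:X^\alpha\to\mathbb R$ such that the function $\mathbf u\mapsto\mathbb E[G(\Phi_t(\mathbf u,\xi))]$ is not continuous at any point of $X^\alpha$.
   Context: $\mathbb T^3=(\mathbb R/2\pi\mathbb Z)^3$; functions and distributions are real valued; pairs are written $\mathbf u=(u,u_t)^{T}$. $\mathcal H^\beta=H^\beta(\mathbb T^3)\times H^{\beta-2}(\mathbb T^3)$. $\mathcal C^\beta$ is the space of pairs with norm $\|\mathbf u\|_{\mathcal C^\beta}=\max(\|(1-\Delta)^{\beta/2}u\|_{L^\infty},\|(1-\Delta)^{\beta/2-1}u_t\|_{L^\infty})$. $S(t)$, $t\ge0$, is the propagator of $\partial_t\mathbf u=-\begin{pmatrix}0&-1\\1+\Delta^2&1\end{pmatrix}\mathbf u$, acting on pairs of distributions. $\bar X^\alpha$ is the set of pairs of distributions $\mathbf u$ with $S(\cdot)\mathbf u\in C([0,\infty);\mathcal C^\alpha)$ and $\|\mathbf u\|_{X^\alpha}:=\sup_{t\ge0}e^{t/8}\|S(t)\mathbf u\|_{\mathcal C^\alpha}<\infty$; $X^\alpha$ is the closure of trigonometric polynomials in $\bar X^\alpha$, with its norm topology and Borel sigma-algebra. $\xi$ is space-time white noise on $\mathbb R\times\mathbb T^3$ (centered Gaussian with $\mathbb E[\langle\phi,\xi\rangle\langle\psi,\xi\rangle]=\langle\phi,\psi\rangle_{L^2}$),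 $\theta_t=\theta_t(\xi)=\int_0^tS(t-t')\begin{pmatrix}0\\\sqrt2\,\xi(t')\end{pmatrix}dt'$. The equation is $\partial_t\mathbf u=-\begin{pmatrix}0&-1\\1+\Delta^2&1\end{pmatrix}\mathbf u-\begin{pmatrix}0\\ u^3\end{pmatrix}+\begin{pmatrix}0\\\sqrt2\xi\end{pmatrix}$ and its flow is $\Phi_t(\mathbf u_0,\xi)=S(t)\mathbf u_0+\theta_t(\xi)+\mathbf v(t)$, where $\mathbf v\in C([0,\infty);\mathcal H^2)$ is the (almost surely globally defined, unique) solution of $\mathbf v(t)=-\int_0^tS(t-t')\begin{pmatrix}0\\ (\pi_1(S(t')\mathbf u_0+\theta_{t'})+v(t'))^3\end{pmatrix}dt'$, with $\pi_1$ the first component and $v=\pi_1\mathbf v$. *)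

theory Defs
  imports "HOL-Probability.Probability" "HOL-Library.Function_Algebras"
begin

section \<open>Functions and distributions on the torus\<close>

text \<open>Functions on the torus are $2\pi$-periodic functions on \<open>real^3\<close>; integrals are taken over one
  period with (unnormalised) Lebesgue measure.\<close>

definition torus :: "(real^3) measure" where
  "torus = restrict_space lborel (cbox 0 (\<chi> i. 2 * pi))"

definition periodic :: "(real^3 \<Rightarrow> real) \<Rightarrow> bool" where
  "periodic \<phi> \<longleftrightarrow> (\<forall>x i. \<phi> (x + axis i (2 * pi)) = \<phi> x)"

primrec partials :: "3 list \<Rightarrow> (real^3 \<Rightarrow> real) \<Rightarrow> real^3 \<Rightarrow> real" where
  "partials [] \<phi> = \<phi>"
| "partials (i # is) \<phi> = (\<lambda>x. frechet_derivative (partials is \<phi>) (at x) (axis i 1))"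

definition test_fns :: "(real^3 \<Rightarrow> real) set" where
  "test_fns = {\<phi>. periodic \<phi> \<and> (\<forall>is x. partials is \<phi> differentiable (at x))}"

text \<open>Real distributions: linear functionals on the test functions, continuous for the family of
  $C^m$-norms. They are set to 0 off the test functions, so that equality of functions is
  equality of distributions; the algebraic operations are the pointwise ones.\<close>

type_synonym dist = "(real^3 \<Rightarrow> real) \<Rightarrow> real"

definition distributions :: "dist set" where
  "distributions = {u.
     (\<forall>\<phi>\<in>test_fns. \<forall>\<psi>\<in>test_fns. u (\<lambda>x. \<phi> x + \<psi> x) = u \<phi> + u \<psi>) \<and>
     (\<forall>\<phi>\<in>test_fns. \<forall>c. u (\<lambda>x. c * \<phi> x) = c * u \<phi>) \<and>
     (\<exists>C m. \<forall>\<phi>\<in>test_fns. \<forall>B. (\<forall>is x. length is \<le> m \<longrightarrow> \<bar>partials is \<phi> x\<bar> \<le> B) \<longrightarrow> \<bar>u \<phi>\<bar> \<le> C * B) \<and>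
     (\<forall>\<phi>. \<phi> \<notin> test_fns \<longrightarrow> u \<phi> = 0)}"

definition dist_of :: "(real^3 \<Rightarrow> real) \<Rightarrow> dist" where
  "dist_of f = (\<lambda>\<phi>. if \<phi> \<in> test_fns then (\<integral>x. f x * \<phi> x \<partial>torus) else 0)"

section \<open>Fourier coefficients and multipliers\<close>

definition freq :: "int^3 \<Rightarrow> real^3" where
  "freq k = (\<chi> i. of_int (k $ i))"

definition fcoeff :: "(real^3 \<Rightarrow> real) \<Rightarrow> int^3 \<Rightarrow> complex" where
  "fcoeff f k = (\<integral>x. complex_of_real (f x) * cis (- (freq k \<bullet> x)) \<partial>torus) / of_real ((2 * pi) ^ 3)"

definition dcoeff :: "dist \<Rightarrow> int^3 \<Rightarrow> complex" where
  "dcoeff u k = Complex (u (\<lambda>x. cos (freq k \<bullet> x))) (- u (\<lambda>x. sin (freq k \<bullet> x))) / of_real ((2 * pi) ^ 3)"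

text \<open>Fourier multiplier $m(D)$ with real even symbol: on test functions by the Fourier series, on
  distributions by transposition.\<close>

definition fmult :: "(int^3 \<Rightarrow> real) \<Rightarrow> (real^3 \<Rightarrow> real) \<Rightarrow> real^3 \<Rightarrow> real" where
  "fmult m \<phi> x = Re (\<Sum>\<^sub>\<infinity>k. of_real (m k) * fcoeff \<phi> k * cis (freq k \<bullet> x))"

definition dmult :: "(int^3 \<Rightarrow> real) \<Rightarrow> dist \<Rightarrow> dist" where
  "dmult m u = (\<lambda>\<phi>. if \<phi> \<in> test_fns then u (fmult m \<phi>) else 0)"

text \<open>\<open>japanese s\<close> is the symbol of $(1-\Delta)^{s/2}$.\<close>

definition japanese :: "real \<Rightarrow> int^3 \<Rightarrow> real" where
  "japanese s k = (1 + (norm (freq k))\<^sup>2) powr (s / 2)"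

text \<open>\<open>bessel_Linf s u\<close> is the $L^\infty$-norm of $(1-\Delta)^{s/2}u$, the distribution with Fourier
  coefficients \<open>japanese s k * dcoeff u k\<close>; it is infinite if no $L^\infty$-function has these
  coefficients. The function \<open>f\<close> is unique almost everywhere if it exists.\<close>

definition Linf_norm :: "(real^3 \<Rightarrow> real) \<Rightarrow> ennreal" where
  "Linf_norm f = esssup torus (\<lambda>x. ennreal \<bar>f x\<bar>)"

definition bessel_Linf :: "real \<Rightarrow> dist \<Rightarrow> ennreal" where
  "bessel_Linf s u =
     (INF f \<in> {f \<in> borel_measurable torus. \<forall>k. fcoeff f k = of_real (japanese s k) * dcoeff u k}.
        Linf_norm f)"

definition sobolev_sq :: "real \<Rightarrow> dist \<Rightarrow> ennreal" where
  "sobolev_sq s u = (\<integral>\<^sup>+k. ennreal ((japanese s k * cmod (dcoeff u k))\<^sup>2) \<partial>count_space UNIV)"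

text \<open>The $L^\infty$-function (unique almost everywhere) representing a distribution, if there is one.\<close>

definition fun_of :: "dist \<Rightarrow> real^3 \<Rightarrow> real" where
  "fun_of u = (SOME f. f \<in> borel_measurable torus \<and> Linf_norm f < \<top> \<and> (\<forall>k. fcoeff f k = dcoeff u k))"

section \<open>Pairs of distributions\<close>

type_synonym dpair = "dist \<times> dist"

definition H_norm_sq :: "real \<Rightarrow> dpair \<Rightarrow> ennreal" where
  "H_norm_sq \<beta> u = sobolev_sq \<beta> (fst u) + sobolev_sq (\<beta> - 2) (snd u)"

definition C_norm :: "real \<Rightarrow> dpair \<Rightarrow> ennreal" where
  "C_norm \<beta> u = max (bessel_Linf \<beta> (fst u)) (bessel_Linf (\<beta> - 2) (snd u))"

section \<open>The linear propagator\<close>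

text \<open>For every frequency \<open>k\<close> the symbols below are the entries of the matrix exponential
  $\exp(-tA_k)$ with $A_k = ((0,-1),(1+|k|^4,1))$; see the lemmas that follow.\<close>

definition beam_freq :: "int^3 \<Rightarrow> real" where
  "beam_freq k = sqrt (3 / 4 + norm (freq k) ^ 4)"

definition s11 :: "real \<Rightarrow> int^3 \<Rightarrow> real" where
  "s11 t k = exp (- t / 2) * (cos (t * beam_freq k) + sin (t * beam_freq k) / (2 * beam_freq k))"

definition s12 :: "real \<Rightarrow> int^3 \<Rightarrow> real" where
  "s12 t k = exp (- t / 2) * (sin (t * beam_freq k) / beam_freq k)"

definition s21 :: "real \<Rightarrow> int^3 \<Rightarrow> real" where
  "s21 t k = - (1 + norm (freq k) ^ 4) * exp (- t / 2) * (sin (t * beam_freq k) / beam_freq k)"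

definition s22 :: "real \<Rightarrow> int^3 \<Rightarrow> real" where
  "s22 t k = exp (- t / 2) * (cos (t * beam_freq k) - sin (t * beam_freq k) / (2 * beam_freq k))"

lemma beam_freq_pos: "beam_freq k > 0"
  unfolding beam_freq_def by (simp add: add_pos_nonneg)

lemma beam_freq_sq: "beam_freq k * beam_freq k = 3 / 4 + norm (freq k) ^ 4"
  unfolding beam_freq_def by (simp add: real_sqrt_mult_self)

lemma propagator_symbol_0: "s11 0 k = 1" "s12 0 k = 0" "s21 0 k = 0" "s22 0 k = 1"
  by (simp_all add: s11_def s12_def s21_def s22_def)

lemma propagator_symbol_ode:
  "((\<lambda>t. s11 t k) has_real_derivative s21 t k) (at t)"
  "((\<lambda>t. s12 t k) has_real_derivative s22 t k) (at t)"
  "((\<lambda>t. s21 t k) has_real_derivative (- (1 + norm (freq k) ^ 4) * s11 t k - s21 t k)) (at t)"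
  "((\<lambda>t. s22 t k) has_real_derivative (- (1 + norm (freq k) ^ 4) * s12 t k - s22 t k)) (at t)"
proof -
  define w where "w = beam_freq k"
  have p: "w \<noteq> 0" using beam_freq_pos[of k] by (simp add: w_def)
  have n: "norm (freq k) ^ 4 = w * w - 3 / 4" using beam_freq_sq[of k] by (simp add: w_def)
  have e: "((\<lambda>t. exp (- t / 2)) has_real_derivative - exp (- t / 2) / 2) (at t)" for t :: real
    by (auto intro!: derivative_eq_intros)
  have c: "((\<lambda>t. cos (t * w)) has_real_derivative - (w * sin (t * w))) (at t)" for t :: real
    by (auto intro!: derivative_eq_intros)
  have s: "((\<lambda>t. sin (t * w)) has_real_derivative w * cos (t * w)) (at t)" for t :: real
    by (auto intro!: derivative_eq_intros)
  show "((\<lambda>t. s11 t k) has_real_derivative s21 t k) (at t)"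
    unfolding s11_def s21_def n w_def[symmetric]
    by (rule DERIV_cong, rule DERIV_mult[OF e DERIV_add[OF c DERIV_cdivide[OF s]]])
       (use p in \<open>simp add: field_simps\<close>)
  show "((\<lambda>t. s12 t k) has_real_derivative s22 t k) (at t)"
    unfolding s12_def s22_def n w_def[symmetric]
    by (rule DERIV_cong, rule DERIV_mult[OF e DERIV_cdivide[OF s]])
       (use p in \<open>simp add: field_simps\<close>)
  show "((\<lambda>t. s21 t k) has_real_derivative (- (1 + norm (freq k) ^ 4) * s11 t k - s21 t k)) (at t)"
    unfolding s11_def s21_def n w_def[symmetric]
    by (rule DERIV_cong, rule DERIV_mult[OF DERIV_cmult[OF e] DERIV_cdivide[OF s]])
       (use p in \<open>simp add: field_simps\<close>)
  show "((\<lambda>t. s22 t k) has_real_derivative (- (1 + norm (freq k) ^ 4) * s12 t k - s22 t k)) (at t)"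
    unfolding s12_def s22_def n w_def[symmetric]
    by (rule DERIV_cong, rule DERIV_mult[OF e DERIV_diff[OF c DERIV_cdivide[OF s]]])
       (use p in \<open>simp add: field_simps\<close>)
qed

definition S :: "real \<Rightarrow> dpair \<Rightarrow> dpair" where
  "S t u = (dmult (s11 t) (fst u) + dmult (s12 t) (snd u), dmult (s21 t) (fst u) + dmult (s22 t) (snd u))"

section \<open>The spaces $X^\alpha$\<close>

definition X_norm :: "real \<Rightarrow> dpair \<Rightarrow> ennreal" where
  "X_norm \<alpha> u = (SUP t\<in>{0..}. ennreal (exp (t / 8)) * C_norm \<alpha> (S t u))"

definition Xbar :: "real \<Rightarrow> dpair set" where
  "Xbar \<alpha> = {u \<in> distributions \<times> distributions.
     (\<forall>t\<ge>0. C_norm \<alpha> (S t u) < \<top>) \<and>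
     (\<forall>t\<ge>0. ((\<lambda>s. C_norm \<alpha> (S s u - S t u)) \<longlongrightarrow> 0) (at t within {0..})) \<and>
     X_norm \<alpha> u < \<top>}"

definition trig_polys :: "dist set" where
  "trig_polys = {dist_of (\<lambda>x. \<Sum>k\<in>F. a k * cos (freq k \<bullet> x) + b k * sin (freq k \<bullet> x)) | F a b. finite F}"

definition X_space :: "real \<Rightarrow> dpair set" where
  "X_space \<alpha> = {u \<in> Xbar \<alpha>. \<forall>\<epsilon>>0. \<exists>p \<in> trig_polys \<times> trig_polys. X_norm \<alpha> (u - p) < \<epsilon>}"

definition X_top :: "real \<Rightarrow> dpair topology" where
  "X_top \<alpha> = topology (\<lambda>U. U \<subseteq> X_space \<alpha> \<and>
     (\<forall>u\<in>U. \<exists>\<epsilon>>0. \<forall>w\<in>X_space \<alpha>. X_norm \<alpha> (w - u) < \<epsilon> \<longrightarrow> w \<in> U))"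

lemma openin_X_top: "openin (X_top \<alpha>) U \<longleftrightarrow> U \<subseteq> X_space \<alpha> \<and>
     (\<forall>u\<in>U. \<exists>\<epsilon>>0. \<forall>w\<in>X_space \<alpha>. X_norm \<alpha> (w - u) < \<epsilon> \<longrightarrow> w \<in> U)"
proof -
  let ?P = "\<lambda>U. U \<subseteq> X_space \<alpha> \<and>
     (\<forall>u\<in>U. \<exists>\<epsilon>>0. \<forall>w\<in>X_space \<alpha>. X_norm \<alpha> (w - u) < \<epsilon> \<longrightarrow> w \<in> U)"
  have "istopology ?P"
    unfolding istopology_def
  proof (intro conjI allI impI)
    fix A B assume A: "?P A" and B: "?P B"
    show "A \<inter> B \<subseteq> X_space \<alpha>" using A by blast
    show "\<forall>u\<in>A \<inter> B. \<exists>\<epsilon>>0. \<forall>w\<in>X_space \<alpha>. X_norm \<alpha> (w - u) < \<epsilon> \<longrightarrow> w \<in> A \<inter> B"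
    proof
      fix u assume u: "u \<in> A \<inter> B"
      obtain e1 where "e1 > 0" "\<forall>w\<in>X_space \<alpha>. X_norm \<alpha> (w - u) < e1 \<longrightarrow> w \<in> A" using A u by blast
      moreover obtain e2 where "e2 > 0" "\<forall>w\<in>X_space \<alpha>. X_norm \<alpha> (w - u) < e2 \<longrightarrow> w \<in> B" using B u by blast
      ultimately show "\<exists>\<epsilon>>0. \<forall>w\<in>X_space \<alpha>. X_norm \<alpha> (w - u) < \<epsilon> \<longrightarrow> w \<in> A \<inter> B"
        by (intro exI[of _ "min e1 e2"]) auto
    qed
  next
    fix K assume K: "\<forall>A\<in>K. ?P A"
    show "\<Union> K \<subseteq> X_space \<alpha>" using K by blast
    show "\<forall>u\<in>\<Union> K. \<exists>\<epsilon>>0. \<forall>w\<in>X_space \<alpha>. X_norm \<alpha> (w - u) < \<epsilon> \<longrightarrow> w \<in> \<Union> K"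
    proof
      fix u assume "u \<in> \<Union> K"
      then obtain A where A: "A \<in> K" "u \<in> A" by blast
      then obtain e where "e > 0" "\<forall>w\<in>X_space \<alpha>. X_norm \<alpha> (w - u) < e \<longrightarrow> w \<in> A" using K by blast
      with A(1) show "\<exists>\<epsilon>>0. \<forall>w\<in>X_space \<alpha>. X_norm \<alpha> (w - u) < \<epsilon> \<longrightarrow> w \<in> \<Union> K"
        by (intro exI[of _ e]) blast
    qed
  qed
  then show ?thesis unfolding X_top_def by (simp add: topology_inverse')
qed

lemma topspace_X_top: "topspace (X_top \<alpha>) = X_space \<alpha>"
proof -
  have "openin (X_top \<alpha>) (X_space \<alpha>)" unfolding openin_X_top by (auto intro: exI[of _ 1])
  then show ?thesis by (metis openin_X_top openin_subset openin_topspace subset_antisym)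
qed

definition X_borel :: "real \<Rightarrow> dpair measure" where
  "X_borel \<alpha> = sigma (X_space \<alpha>) {U. openin (X_top \<alpha>) U}"

section \<open>White noise and the stochastic convolution\<close>

definition L2_spacetime :: "(real \<times> (real^3) \<Rightarrow> real) set" where
  "L2_spacetime = {f \<in> borel_measurable (lborel \<Otimes>\<^sub>M torus). integrable (lborel \<Otimes>\<^sub>M torus) (\<lambda>z. (f z)\<^sup>2)}"

definition centered_gaussian :: "'w measure \<Rightarrow> ('w \<Rightarrow> real) \<Rightarrow> bool" where
  "centered_gaussian M Y \<longleftrightarrow> Y \<in> borel_measurable M \<and>
     ((AE \<omega> in M. Y \<omega> = 0) \<or> (\<exists>\<sigma>>0. distributed M lborel Y (normal_density 0 \<sigma>)))"

text \<open>\<open>\<xi> f\<close> is the random variable $\langle f,\xi\rangle$, for $f\in L^2(\mathbb R\times\mathbb T^3)$; the family is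
  jointly Gaussian.\<close>

definition white_noise :: "'w measure \<Rightarrow> ((real \<times> (real^3) \<Rightarrow> real) \<Rightarrow> 'w \<Rightarrow> real) \<Rightarrow> bool" where
  "white_noise M \<xi> \<longleftrightarrow> prob_space M \<and>
     (\<forall>F a. finite F \<longrightarrow> F \<subseteq> L2_spacetime \<longrightarrow> centered_gaussian M (\<lambda>\<omega>. \<Sum>f\<in>F. a f * \<xi> f \<omega>)) \<and>
     (\<forall>f\<in>L2_spacetime. \<forall>g\<in>L2_spacetime.
        (\<integral>\<omega>. \<xi> f \<omega> * \<xi> g \<omega> \<partial>M) = (\<integral>z. f z * g z \<partial>(lborel \<Otimes>\<^sub>M torus)))"

text \<open>\<open>\<theta>\<close> is a version, with almost surely weakly continuous paths in the space of pairs of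
  distributions, of $\theta_t = \int_0^t S(t-t')(0,\sqrt2\,\xi(t'))\,dt'$: the (Wiener) integral is obtained
  by moving the multipliers $s_{12}(t-t')$, $s_{22}(t-t')$ to the test function. Any two such
  versions are indistinguishable.\<close>

definition stochastic_convolution ::
  "'w measure \<Rightarrow> ((real \<times> (real^3) \<Rightarrow> real) \<Rightarrow> 'w \<Rightarrow> real) \<Rightarrow> (real \<Rightarrow> 'w \<Rightarrow> dpair) \<Rightarrow> bool" where
  "stochastic_convolution M \<xi> \<theta> \<longleftrightarrow>
     (\<forall>t\<ge>0. \<forall>\<phi>\<in>test_fns.
        (AE \<omega> in M. fst (\<theta> t \<omega>) \<phi> =
           \<xi> (\<lambda>(t', x). indicator {0..t} t' * (sqrt 2 * fmult (s12 (t - t')) \<phi> x)) \<omega>) \<and>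
        (AE \<omega> in M. snd (\<theta> t \<omega>) \<phi> =
           \<xi> (\<lambda>(t', x). indicator {0..t} t' * (sqrt 2 * fmult (s22 (t - t')) \<phi> x)) \<omega>)) \<and>
     (AE \<omega> in M. (\<forall>t\<ge>0. \<theta> t \<omega> \<in> distributions \<times> distributions) \<and>
        (\<forall>\<phi>\<in>test_fns. continuous_on {0..} (\<lambda>t. fst (\<theta> t \<omega>) \<phi>) \<and>
                        continuous_on {0..} (\<lambda>t. snd (\<theta> t \<omega>) \<phi>)))"

section \<open>The flow\<close>

definition cube :: "dist \<Rightarrow> dist" where
  "cube u = dist_of (\<lambda>x. (fun_of u x) ^ 3)"

text \<open>Solutions \<open>v\<close> of the mild equation with path \<open>z\<close> of the stochastic convolution and initial
  datum \<open>u0\<close>; the integral is tested against test functions. Paths are functions on all of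
  \<open>real\<close>, set to 0 at negative times so that uniqueness makes sense.\<close>

definition mild_solution :: "(real \<Rightarrow> dpair) \<Rightarrow> dpair \<Rightarrow> (real \<Rightarrow> dpair) \<Rightarrow> bool" where
  "mild_solution z u0 v \<longleftrightarrow>
     (\<forall>t<0. v t = 0) \<and>
     (\<forall>t\<ge>0. v t \<in> distributions \<times> distributions \<and> H_norm_sq 2 (v t) < \<top>) \<and>
     (\<forall>t\<ge>0. ((\<lambda>s. H_norm_sq 2 (v s - v t)) \<longlongrightarrow> 0) (at t within {0..})) \<and>
     (\<forall>t\<ge>0. \<forall>\<phi>\<in>test_fns.
        let I = (\<lambda>t'. S (t - t') (0, cube (fst (S t' u0 + z t' + v t')))) in
        set_integrable lborel {0..t} (\<lambda>t'. fst (I t') \<phi>) \<and>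
        set_integrable lborel {0..t} (\<lambda>t'. snd (I t') \<phi>) \<and>
        fst (v t) \<phi> = - (LBINT t':{0..t}. fst (I t') \<phi>) \<and>
        snd (v t) \<phi> = - (LBINT t':{0..t}. snd (I t') \<phi>))"

text \<open>The value 0 for the remainder is a convention for the exceptional null event on which the
  mild equation is not globally well posed.\<close>

definition remainder :: "(real \<Rightarrow> dpair) \<Rightarrow> dpair \<Rightarrow> real \<Rightarrow> dpair" where
  "remainder z u0 = (if \<exists>!v. mild_solution z u0 v then (THE v. mild_solution z u0 v) else (\<lambda>t. 0))"

definition flow :: "(real \<Rightarrow> 'w \<Rightarrow> dpair) \<Rightarrow> real \<Rightarrow> dpair \<Rightarrow> 'w \<Rightarrow> dpair" where
  "flow \<theta> t u0 \<omega> = S t u0 + \<theta> t \<omega> + remainder (\<lambda>s. \<theta> s \<omega>) u0 t"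

section \<open>The transition semigroup and the strong Feller property\<close>

text \<open>Since the flow is only defined up to null events, expectations are taken with respect to the
  completed probability. The values of \<open>G\<close> outside \<open>X_space \<alpha>\<close> are immaterial, because the flow
  almost surely stays in \<open>X_space \<alpha>\<close>.\<close>

definition transition :: "'w measure \<Rightarrow> (real \<Rightarrow> 'w \<Rightarrow> dpair) \<Rightarrow> real \<Rightarrow> (dpair \<Rightarrow> real) \<Rightarrow> dpair \<Rightarrow> real" where
  "transition M \<theta> t G u = (\<integral>\<omega>. G (flow \<theta> t u \<omega>) \<partial>(completion M))"

definition bounded_measurable :: "real \<Rightarrow> (dpair \<Rightarrow> real) set" where
  "bounded_measurable \<alpha> = {G \<in> borel_measurable (X_borel \<alpha>). \<exists>B. \<forall>u\<in>X_space \<alpha>. \<bar>G u\<bar> \<le> B}"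

definition strong_feller :: "real \<Rightarrow> 'w measure \<Rightarrow> (real \<Rightarrow> 'w \<Rightarrow> dpair) \<Rightarrow> bool" where
  "strong_feller \<alpha> M \<theta> \<longleftrightarrow>
     (\<forall>t>0. \<forall>G\<in>bounded_measurable \<alpha>. continuous_map (X_top \<alpha>) euclideanreal (transition M \<theta> t G))"

end

theory Submission
  imports Defs
begin

text \<open>The witness of discontinuity is the indicator function of a set of pairs of distributions that is
cut out by one asymptotic condition on Fourier coefficients. Let $k_m = (2^m, 0, 0)$ and call a
distribution \<open>decaying\<close> if the real part of its coefficient at $k_m$ is $o(2^{-m})$. The flow is the
sum of $S(t)u$, of the stochastic convolution and of a remainder, and only the first term can
violate this condition. The remainder is in $H^2$, so its coefficient at $k_m$ is $O(4^{-m})$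
(\<open>remainder_decaying\<close>). The coefficients of $\theta_t$ at $k_m$ have standard deviation
$O(4^{-m})$ as well, because the symbol $s_{12}$, through which the noise enters the first
component, gains two derivatives; the second moments of $2^m$ times these coefficients are
summable, hence $\theta_t$ decays almost surely
(\<open>stochastic_convolution_decaying\<close>). Consequently the law of the flow gives the set mass 1 or 0,
according to whether the first component of $S(t)u$ decays or not, and the transition semigroup
maps the indicator function of the set to another indicator function (\<open>transition_decaying\<close>).

This second function is nowhere continuous, because both of its values are taken on a dense set.
Trigonometric polynomials are dense in $X^\alpha$ by construction, and $S(t)$ maps them to
trigonometric polynomials, which decay. On the other hand $X^\alpha$ has room for coefficients of
size $2^{-m}$ at $k_m$, since $\sum_m 2^{\alpha m} 2^{-m}$ converges. For such a datum $w$ the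
rescaled coefficients of $S(t)w$ are essentially $e^{-t/2}\cos(t\omega_m)$ with
$\omega_m \approx 4^m$; they cannot tend to 0, because $\cos(4x) = 8\cos^4 x - 8\cos^2 x + 1$ is close
to 1 if $\cos x$ is close to 0 (\<open>s11_lacunary_not_null\<close>). The decaying data form a linear subspace, so
adding to a decaying datum a small vector $w - p$ with a trigonometric polynomial $p$ destroys
the decay (\<open>decaying_both_dense\<close>).

The concrete elements of $X^\alpha$ are obtained from absolutely convergent Fourier series: a weighted $\ell^1$-norm of the coefficients dominates the norm of
$\mathcal C^\alpha$, is increased at most by the factor $4e^{-t/2}$ under $S(t)$ (\<open>coeff_weight_S\<close>), and is
compatible with truncation to finitely many frequencies (\<open>wiener_norm_imp_X_space\<close>). Conversely, every Fourier
coefficient is continuous on $X^\alpha$, which makes the set Borel.\<close>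

section \<open>Characters of the torus\<close>

lemma space_torus [simp]: "space torus = cbox 0 (\<chi> i. 2 * pi)"
  by (simp add: torus_def space_restrict_space)

lemma finite_measure_torus: "finite_measure torus"
proof (rule finite_measureI)
  have "emeasure lborel (cbox 0 (\<chi> i. 2 * pi) :: (real^3) set) < \<infinity>"
    by (rule emeasure_lborel_cbox_finite)
  then show "emeasure torus (space torus) \<noteq> \<infinity>"
    unfolding space_torus unfolding torus_def by (subst emeasure_restrict_space) auto
qed

interpretation torus: finite_measure torus
  by (rule finite_measure_torus)

lemma measurable_torus:
  "f \<in> borel_measurable borel \<Longrightarrow> f \<in> borel_measurable torus"
  unfolding torus_def by (rule measurable_restrict_space1) simp

lemma integrable_torus_bounded:
  fixes f :: "real^3 \<Rightarrow> 'b::{banach, second_countable_topology}"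
  assumes "f \<in> borel_measurable torus" "\<And>x. norm (f x) \<le> B"
  shows "integrable torus f"
  by (rule torus.integrable_const_bound[of _ B]) (simp_all add: assms)

lemma freq_uminus: "freq (- k) = - freq k"
  by (simp add: freq_def vec_eq_iff)

lemma freq_diff: "freq (j - k) = freq j - freq k"
  by (simp add: freq_def vec_eq_iff)

lemma integral_circle:
  fixes n :: int
  shows "(\<integral>y. indicator {0..2 * pi} y *\<^sub>R cis (of_int n * y) \<partial>lborel) =
    (if n = 0 then complex_of_real (2 * pi) else 0)"
proof (cases "n = 0")
  case True
  then show ?thesis by (simp add: cis_zero scaleR_conv_of_real)
next
  case False
  have "((\<lambda>y. cis (of_int n * y) / (\<i> * of_int n)) has_vector_derivative cis (of_int n * y))
      (at y within {0..2 * pi})" for y :: real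
  proof -
    have "((\<lambda>y. cis (of_int n * y) / (\<i> * of_int n)) has_derivative
        (\<lambda>h. ((of_int n * h) *\<^sub>R (\<i> * cis (of_int n * y))) / (\<i> * of_int n))) (at y within {0..2 * pi})"
      by (intro bounded_linear.has_derivative[OF bounded_linear_divide] has_derivative_cis has_derivative_mult_right has_derivative_ident)
    also have "(\<lambda>h. ((of_int n * h) *\<^sub>R (\<i> * cis (of_int n * y))) / (\<i> * of_int n)) =
        (\<lambda>h. h *\<^sub>R cis (of_int n * y))"
    proof
      show "((of_int n * h) *\<^sub>R (\<i> * cis (of_int n * y))) / (\<i> * of_int n) = h *\<^sub>R cis (of_int n * y)"
        for h
        using False by (simp add: scaleR_conv_of_real nonzero_divide_eq_eq mult_ac)
    qed
    finally show ?thesis by (simp add: has_vector_derivative_def)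
  qed
  then have "(\<integral>y. indicator {0..2 * pi} y *\<^sub>R cis (of_int n * y) \<partial>lborel) =
      cis (of_int n * (2 * pi)) / (\<i> * of_int n) - cis (of_int n * 0) / (\<i> * of_int n)"
    by (intro integral_FTC_atLeastAtMost) (auto intro!: continuous_intros)
  also have "cis (of_int n * (2 * pi)) = 1"
    using cis_multiple_2pi[of "of_int n"] by (simp add: mult_ac)
  finally show ?thesis using False by simp
qed

text \<open>Orthogonality of the characters: the integral factorises over the three coordinates, and the
factor of a coordinate with nonzero frequency is the integral of a full number of periods.\<close>

lemma integral_character:
  "(\<integral>x. cis (freq k \<bullet> x) \<partial>torus) = (if k = 0 then of_real ((2 * pi) ^ 3) else 0)"
proof -
  define g :: "real^3 \<Rightarrow> real \<Rightarrow> complex"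
    where "g b y = indicator {0..2 * pi} y *\<^sub>R cis (freq k \<bullet> b * y)" for b y
  interpret product_sigma_finite "\<lambda>_ :: real^3. lborel :: real measure" by standard
  have mem: "x \<in> cbox 0 (\<chi> i. 2 * pi) \<longleftrightarrow> (\<forall>b\<in>Basis. x \<bullet> b \<in> {0..2 * pi})" for x :: "real^3"
    by (auto simp: mem_box Basis_vec_def inner_axis)
  have split: "indicator (cbox 0 (\<chi> i. 2 * pi)) x *\<^sub>R cis (freq k \<bullet> x) = (\<Prod>b\<in>Basis. g b (x \<bullet> b))" for x
  proof -
    have "cis (freq k \<bullet> x) = (\<Prod>b\<in>Basis. cis ((freq k \<bullet> b) * (x \<bullet> b)))"
      by (subst euclidean_inner) (simp add: cis_conv_exp exp_sum sum_distrib_left)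
    moreover have "indicator (cbox 0 (\<chi> i. 2 * pi)) x = (\<Prod>b\<in>Basis. indicator {0..2 * pi} (x \<bullet> b) :: real)"
      by (auto simp: indicator_def mem)
    ultimately show ?thesis
      by (simp add: g_def scaleR_conv_of_real prod.distrib)
  qed
  have fac: "(\<integral>y. g (axis i 1) y \<partial>lborel) = (if k $ i = 0 then of_real (2 * pi) else 0)" for i
    using integral_circle[of "k $ i"] by (simp add: g_def freq_def inner_axis)
  have int: "integrable lborel (g b)" for b
    unfolding g_def by (rule borel_integrable_compact) (auto intro!: continuous_intros)
  have "(\<integral>x. cis (freq k \<bullet> x) \<partial>torus) = (\<integral>x. (\<Prod>b\<in>Basis. g b (x \<bullet> b)) \<partial>lborel)"
    unfolding torus_def by (subst integral_restrict_space) (simp, simp only: split)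
  also have "\<dots> = (\<integral>x. (\<Prod>b\<in>Basis. g b ((\<Sum>b\<in>Basis. x b *\<^sub>R b) \<bullet> b)) \<partial>(\<Pi>\<^sub>M b\<in>Basis. lborel))"
  proof (subst lborel_eq[where 'a = "real^3"], subst integral_distr)
    show "(\<lambda>x. \<Prod>b\<in>Basis. g b (x \<bullet> b)) \<in> borel_measurable borel"
    proof (rule borel_measurable_prod)
      show "(\<lambda>x. g b (x \<bullet> b)) \<in> borel_measurable borel" for b
        by (rule measurable_compose[OF _ borel_measurable_integrable[OF int], unfolded measurable_lborel2]) simp
    qed
    show "(\<lambda>f. \<Sum>b\<in>Basis. f b *\<^sub>R b) \<in> (\<Pi>\<^sub>M b\<in>(Basis :: (real^3) set). lborel) \<rightarrow>\<^sub>M borel"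
      by measurable
  qed (rule refl)
  also have "\<dots> = (\<integral>x. (\<Prod>b\<in>Basis. g b (x b)) \<partial>(\<Pi>\<^sub>M b\<in>Basis. lborel))"
    by (rule Bochner_Integration.integral_cong[OF refl], rule prod.cong[OF refl])
      simp
  also have "\<dots> = (\<Prod>b\<in>Basis. \<integral>y. g b y \<partial>lborel)"
    by (rule product_integral_prod) (auto intro: int)
  also have "\<dots> = (\<Prod>i\<in>UNIV. \<integral>y. g (axis i 1) y \<partial>lborel)"
  proof -
    have B: "(Basis :: (real^3) set) = (\<lambda>i. axis i 1) ` UNIV" by (auto simp: Basis_vec_def)
    show ?thesis unfolding B by (subst prod.reindex) (auto intro!: injI simp: axis_eq_axis)
  qed
  also have "\<dots> = (if k = 0 then of_real ((2 * pi) ^ 3) else 0)"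
    unfolding fac by (auto simp: vec_eq_iff)
  finally show ?thesis .
qed

section \<open>Fourier coefficients of trigonometric functions and of absolutely convergent series\<close>

abbreviation cos_mode :: "int^3 \<Rightarrow> real^3 \<Rightarrow> real" where
  "cos_mode k \<equiv> \<lambda>x. cos (freq k \<bullet> x)"

abbreviation sin_mode :: "int^3 \<Rightarrow> real^3 \<Rightarrow> real" where
  "sin_mode k \<equiv> \<lambda>x. sin (freq k \<bullet> x)"

lemma borel_measurable_trig [measurable]:
  "cos_mode k \<in> borel_measurable borel" "sin_mode k \<in> borel_measurable borel"
  "(\<lambda>x. cis (freq k \<bullet> x)) \<in> borel_measurable borel"
  "(\<lambda>x. cis (- (freq k \<bullet> x))) \<in> borel_measurable borel"
  by (intro borel_measurable_continuous_onI continuous_intros)+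

lemmas borel_measurable_trig_torus [measurable] = borel_measurable_trig[THEN measurable_torus]

lemma integrable_character: "integrable torus (\<lambda>x. cis (freq k \<bullet> x))"
  by (rule integrable_torus_bounded[of _ 1]) simp_all

lemma fcoeff_add:
  assumes "integrable torus f" "integrable torus g"
  shows "fcoeff (\<lambda>x. f x + g x) k = fcoeff f k + fcoeff g k"
proof -
  have i: "integrable torus (\<lambda>x. complex_of_real (h x) * cis (- (freq k \<bullet> x)))" if "integrable torus h" for h
    by (rule Bochner_Integration.integrable_bound[OF that])
       (use that in \<open>auto simp: norm_mult intro!: borel_measurable_times borel_measurable_of_real\<close>)
  show ?thesis
    unfolding fcoeff_def
    by (simp add: distrib_right Bochner_Integration.integral_add[OF assms[THEN i]] add_divide_distrib)
qed

lemma fcoeff_cmult: "fcoeff (\<lambda>x. c * f x) k = of_real c * fcoeff f k"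
  unfolding fcoeff_def by (simp add: mult.assoc)

lemma fcoeff_sum:
  assumes "finite F" "\<And>i. i \<in> F \<Longrightarrow> integrable torus (f i)"
  shows "fcoeff (\<lambda>x. \<Sum>i\<in>F. f i x) k = (\<Sum>i\<in>F. fcoeff (f i) k)"
  using assms
proof (induction F)
  case empty
  then show ?case by (simp add: fcoeff_def)
next
  case (insert i F)
  then show ?case by (simp add: fcoeff_add)
qed

lemma integrable_cos_mode: "integrable torus (cos_mode k)"
  and integrable_sin_mode: "integrable torus (sin_mode k)"
  by (rule integrable_torus_bounded[of _ 1]; simp)+

lemma fcoeff_cos_mode: "fcoeff (cos_mode k) j = of_bool (j = k) / 2 + of_bool (j = - k) / 2"
proof -
  have "complex_of_real (cos_mode k x) * cis (- (freq j \<bullet> x)) =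
      cis (freq (k - j) \<bullet> x) / 2 + cis (freq (- k - j) \<bullet> x) / 2" for x
    by (simp add: freq_diff freq_uminus inner_diff_left complex_eq_iff cos_diff sin_diff cos_add sin_add
        field_simps)
  then have "fcoeff (cos_mode k) j = (\<integral>x. cis (freq (k - j) \<bullet> x) / 2 + cis (freq (- k - j) \<bullet> x) / 2 \<partial>torus)
      / of_real ((2 * pi) ^ 3)"
    by (simp add: fcoeff_def)
  also have "\<dots> = of_bool (j = k) / 2 + of_bool (j = - k) / 2"
    by (subst Bochner_Integration.integral_add)
       (auto simp: integral_character integrable_character add_divide_distrib minus_equation_iff)
  finally show ?thesis .
qed

lemma fcoeff_sin_mode: "fcoeff (sin_mode k) j = of_bool (j = k) / (2 * \<i>) - of_bool (j = - k) / (2 * \<i>)"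
proof -
  have "complex_of_real (sin_mode k x) * cis (- (freq j \<bullet> x)) =
      cis (freq (k - j) \<bullet> x) / (2 * \<i>) - cis (freq (- k - j) \<bullet> x) / (2 * \<i>)" for x
    by (simp add: freq_diff freq_uminus inner_diff_left 
        complex_eq_iff cos_diff sin_diff cos_add sin_add Re_divide Im_divide field_simps)
  then have "fcoeff (sin_mode k) j = (\<integral>x. cis (freq (k - j) \<bullet> x) / (2 * \<i>) - cis (freq (- k - j) \<bullet> x) / (2 * \<i>) \<partial>torus)
      / of_real ((2 * pi) ^ 3)"
    by (simp add: fcoeff_def)
  also have "\<dots> = of_bool (j = k) / (2 * \<i>) - of_bool (j = - k) / (2 * \<i>)"
    by (subst Bochner_Integration.integral_diff)
       (auto simp: integral_character integrable_character diff_divide_distrib minus_equation_iff)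
  finally show ?thesis .
qed

lemma freq_zero: "freq 0 = 0"
  by (simp add: freq_def vec_eq_iff)

lemma countable_int3: "countable (UNIV :: (int^3) set)"
  using countable_vector[of "\<lambda>_. UNIV :: int set"] by simp

text \<open>Absolutely summable coefficients are the Fourier coefficients of a bounded function, the sum of the
series; Fubini's theorem and orthogonality recover the coefficients, and the symmetry makes the sum
real.\<close>

lemma Wiener_algebra_function:
  fixes c :: "int^3 \<Rightarrow> complex"
  assumes sm: "integrable (count_space UNIV) c" and sym: "\<And>k. c (- k) = cnj (c k)"
  obtains f where "f \<in> borel_measurable torus"
    "\<And>x. \<bar>f x\<bar> \<le> (\<integral>k. cmod (c k) \<partial>count_space UNIV)" "\<And>k. fcoeff f k = c k"
proof
  let ?C = "count_space (UNIV :: (int^3) set)"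
  interpret sigma_finite_measure ?C
    by (rule sigma_finite_measure_count_space_countable) (rule countable_int3)
  interpret P: pair_sigma_finite torus ?C ..
  define F where "F x = (\<integral>k. c k * cis (freq k \<bullet> x) \<partial>?C)" for x
  define f where "f x = Re (F x)" for x
  have int: "integrable ?C (\<lambda>k. c k * cis (freq k \<bullet> x))" for x
    by (rule Bochner_Integration.integrable_bound[OF sm]) (auto simp: norm_mult)
  have real: "complex_of_real (f x) = F x" for x
  proof -
    have "cnj (F x) = (\<integral>k. cnj (c k * cis (freq k \<bullet> x)) \<partial>?C)"
      unfolding F_def by (subst Bochner_Integration.integral_cnj) (rule refl)
    also have "\<dots> = (\<integral>k. c (- k) * cis (freq (- k) \<bullet> x) \<partial>?C)"
      by (simp add: sym freq_uminus cis_cnj del: Bochner_Integration.integral_cnj)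
    also have "\<dots> = F x"
      unfolding F_def
      by (rule integral_bij_count_space) (auto intro!: bij_betwI[of _ _ _ uminus])
    finally show ?thesis
      unfolding f_def by (metis Reals_cnj_iff of_real_Re)
  qed
  have mp: "(\<lambda>(x, k). c k * cis (freq k \<bullet> x) * cis (- (freq j \<bullet> x))) \<in> borel_measurable (torus \<Otimes>\<^sub>M ?C)" for j
  proof -
    have "(\<lambda>(k, x). c k * cis (freq k \<bullet> x) * cis (- (freq j \<bullet> x))) \<in> borel_measurable (?C \<Otimes>\<^sub>M torus)"
      by (rule measurable_pair_measure_countable1[OF countable_int3]) simp
    from measurable_compose[OF measurable_pair_swap' this] show ?thesis
      by (simp add: case_prod_beta' o_def)
  qed
  have intp: "integrable (torus \<Otimes>\<^sub>M ?C) (\<lambda>(x, k). c k * cis (freq k \<bullet> x) * cis (- (freq j \<bullet> x)))" for j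
  proof (rule P.Fubini_integrable[OF mp])
    show "integrable torus (\<lambda>x. \<integral>y. norm (case (x, y) of (x, k) \<Rightarrow> c k * cis (freq k \<bullet> x) * cis (- (freq j \<bullet> x))) \<partial>?C)"
      by (simp add: norm_mult)
    show "AE x in torus. integrable ?C (\<lambda>y. case (x, y) of (x, k) \<Rightarrow> c k * cis (freq k \<bullet> x) * cis (- (freq j \<bullet> x)))"
      by (auto intro!: AE_I2 integrable_mult_left int)
  qed
  have swap: "(\<integral>x. F x * cis (- (freq j \<bullet> x)) \<partial>torus) =
      (\<integral>k. (\<integral>x. c k * cis (freq k \<bullet> x) * cis (- (freq j \<bullet> x)) \<partial>torus) \<partial>?C)" for j
    using P.Fubini_integral[OF intp[of j]] by (simp add: F_def)
  show "fcoeff f j = c j" for j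
  proof -
    have eq: "c k * cis (freq k \<bullet> x) * cis (- (freq j \<bullet> x)) = c k * cis (freq (k - j) \<bullet> x)" for k x
      by (simp add: freq_diff inner_diff_left cis_mult mult.assoc)
    have inner: "(\<integral>x. c k * cis (freq k \<bullet> x) * cis (- (freq j \<bullet> x)) \<partial>torus) =
        c k * (if k = j then of_real ((2 * pi) ^ 3) else 0)" for k
      unfolding eq by (simp add: integral_character)
    have "(\<integral>x. F x * cis (- (freq j \<bullet> x)) \<partial>torus) =
        (\<integral>k. c k * (if k = j then of_real ((2 * pi) ^ 3) else 0) \<partial>?C)"
      unfolding swap inner ..
    also have "\<dots> = (\<Sum>k\<in>{j}. c k * of_real ((2 * pi) ^ 3))"
    proof (subst lebesgue_integral_count_space_finite_support)
      have sub: "{a \<in> UNIV. c a * (if a = j then of_real ((2 * pi) ^ 3) else 0) \<noteq> 0} \<subseteq> {j}" by auto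
      then show "finite {a \<in> UNIV. c a * (if a = j then of_real ((2 * pi) ^ 3) else 0) \<noteq> 0}"
        by (rule finite_subset) simp
      show "(\<Sum>a | a \<in> UNIV \<and> c a * (if a = j then of_real ((2 * pi) ^ 3) else 0) \<noteq> 0.
          c a * (if a = j then of_real ((2 * pi) ^ 3) else 0)) = (\<Sum>k\<in>{j}. c k * of_real ((2 * pi) ^ 3))"
        using sub by (intro sum.mono_neutral_cong_left) auto
    qed
    finally show ?thesis by (simp add: fcoeff_def real)
  qed
  have "F \<in> borel_measurable torus"
    using borel_measurable_lebesgue_integral[OF mp[of 0]]
    unfolding F_def by (simp add: freq_zero)
  then show "f \<in> borel_measurable torus"
    unfolding f_def by (rule measurable_compose) simp
  show "\<bar>f x\<bar> \<le> (\<integral>k. cmod (c k) \<partial>?C)" for x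
  proof -
    have "\<bar>f x\<bar> \<le> cmod (F x)" unfolding f_def by (rule abs_Re_le_cmod)
    also have "\<dots> \<le> (\<integral>k. cmod (c k * cis (freq k \<bullet> x)) \<partial>?C)"
      unfolding F_def by (rule integral_norm_bound)
    finally show ?thesis by (simp add: norm_mult)
  qed
qed

section \<open>Distributions and Fourier multipliers\<close>

text \<open>Linear combinations of the two modes of one frequency are closed under differentiation, which is
the form that an induction over iterated derivatives needs.\<close>

lemma partials_trig:
  "\<exists>a' b'. partials is (\<lambda>x. a * cos_mode k x + b * sin_mode k x) = (\<lambda>x. a' * cos_mode k x + b' * sin_mode k x)"
proof (induction "is")
  case (Cons i "is")
  then obtain a' b' where ab: "partials is (\<lambda>x. a * cos_mode k x + b * sin_mode k x) = (\<lambda>x. a' * cos_mode k x + b' * sin_mode k x)"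
    by blast
  have "((\<lambda>x. a' * cos_mode k x + b' * sin_mode k x) has_derivative
      (\<lambda>h. a' * (- sin_mode k x * (freq k \<bullet> h)) + b' * (cos_mode k x * (freq k \<bullet> h)))) (at x)" for x
    by (auto intro!: derivative_eq_intros simp: mult_ac)
  from frechet_derivative_at[OF this, symmetric]
  have "partials (i # is) (\<lambda>x. a * cos_mode k x + b * sin_mode k x) =
      (\<lambda>x. (b' * (freq k $ i)) * cos_mode k x + (- a' * (freq k $ i)) * sin_mode k x)"
    by (simp add: ab inner_axis mult_ac)
  then show ?case by blast
qed auto

lemma trig_test_fn: "(\<lambda>x. a * cos_mode k x + b * sin_mode k x) \<in> test_fns"
proof -
  have per: "freq k \<bullet> (x + axis i (2 * pi)) = freq k \<bullet> x + 2 * pi * of_int (k $ i)" for x i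
    by (simp add: inner_add_right inner_axis freq_def)
  have "partials is (\<lambda>x. a * cos_mode k x + b * sin_mode k x) differentiable (at x)" for "is" x
  proof -
    obtain a' b' where ab: "partials is (\<lambda>x. a * cos_mode k x + b * sin_mode k x) = (\<lambda>x. a' * cos_mode k x + b' * sin_mode k x)"
      using partials_trig by blast
    have "((\<lambda>x. a' * cos_mode k x + b' * sin_mode k x) has_derivative
        (\<lambda>h. a' * (- sin_mode k x * (freq k \<bullet> h)) + b' * (cos_mode k x * (freq k \<bullet> h)))) (at x)"
      by (auto intro!: derivative_eq_intros simp: mult_ac)
    then show ?thesis unfolding ab by (rule differentiableI)
  qed
  then show ?thesis
    unfolding test_fns_def periodic_def by (simp add: per cos_add sin_add)
qed

lemma cos_mode_test_fn: "cos_mode k \<in> test_fns" and sin_mode_test_fn: "sin_mode k \<in> test_fns"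
  using trig_test_fn[of 1 k 0] trig_test_fn[of 0 k 1] by simp_all

lemma test_fn_continuous: "\<phi> \<in> test_fns \<Longrightarrow> continuous_on UNIV \<phi>"
  using differentiable_imp_continuous_within[of \<phi>] partials.simps(1)
  unfolding test_fns_def continuous_on_eq_continuous_within mem_Collect_eq by metis

lemma test_fn_add:
  assumes "\<phi> \<in> test_fns" "\<psi> \<in> test_fns"
  shows "(\<lambda>x. \<phi> x + \<psi> x) \<in> test_fns"
proof -
  have "partials is (\<lambda>x. \<phi> x + \<psi> x) = (\<lambda>x. partials is \<phi> x + partials is \<psi> x)" for "is"
  proof (induction "is")
    case (Cons i "is")
    have "(\<lambda>h. frechet_derivative (partials is \<phi>) (at x) h + frechet_derivative (partials is \<psi>) (at x) h) =
        frechet_derivative (\<lambda>x. partials is \<phi> x + partials is \<psi> x) (at x)" for x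
      by (rule frechet_derivative_at, rule has_derivative_add)
         (use assms in \<open>auto simp: test_fns_def frechet_derivative_works[symmetric]\<close>)
    from fun_cong[OF this] show ?case using Cons by simp
  qed simp
  then show ?thesis using assms unfolding test_fns_def periodic_def by simp
qed

lemma test_fn_cmult:
  assumes "\<phi> \<in> test_fns"
  shows "(\<lambda>x. a * \<phi> x) \<in> test_fns"
proof -
  have "partials is (\<lambda>x. a * \<phi> x) = (\<lambda>x. a * partials is \<phi> x)" for "is"
  proof (induction "is")
    case (Cons i "is")
    have "(\<lambda>h. a * frechet_derivative (partials is \<phi>) (at x) h) =
        frechet_derivative (\<lambda>x. a * partials is \<phi> x) (at x)" for x
      by (rule frechet_derivative_at, rule has_derivative_mult_right)
         (use assms in \<open>auto simp: test_fns_def frechet_derivative_works[symmetric]\<close>)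
    from fun_cong[OF this] show ?case using Cons by simp
  qed simp
  then show ?thesis using assms unfolding test_fns_def periodic_def by simp
qed

lemma dist_add: "u \<in> distributions \<Longrightarrow> \<phi> \<in> test_fns \<Longrightarrow> \<psi> \<in> test_fns \<Longrightarrow> u (\<lambda>x. \<phi> x + \<psi> x) = u \<phi> + u \<psi>"
  and dist_cmult: "u \<in> distributions \<Longrightarrow> \<phi> \<in> test_fns \<Longrightarrow> u (\<lambda>x. c * \<phi> x) = c * u \<phi>"
  unfolding distributions_def by blast+

lemma distributions_diff:
  assumes "u \<in> distributions" "v \<in> distributions"
  shows "u - v \<in> distributions"
proof -
  obtain C m D n where
    u: "\<And>\<phi> B. \<phi> \<in> test_fns \<Longrightarrow> (\<And>is x. length is \<le> m \<Longrightarrow> \<bar>partials is \<phi> x\<bar> \<le> B) \<Longrightarrow> \<bar>u \<phi>\<bar> \<le> C * B" and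
    v: "\<And>\<phi> B. \<phi> \<in> test_fns \<Longrightarrow> (\<And>is x. length is \<le> n \<Longrightarrow> \<bar>partials is \<phi> x\<bar> \<le> B) \<Longrightarrow> \<bar>v \<phi>\<bar> \<le> D * B"
    using assms unfolding distributions_def mem_Collect_eq by metis
  have "\<bar>(u - v) \<phi>\<bar> \<le> (C + D) * B"
    if "\<phi> \<in> test_fns" "\<And>is x. length is \<le> max m n \<Longrightarrow> \<bar>partials is \<phi> x\<bar> \<le> B" for \<phi> B
    using u[OF that(1), of B] v[OF that(1), of B] that(2) by (simp add: distrib_right le_max_iff_disj)
  moreover have "(u - v) \<phi> = 0" if "\<phi> \<notin> test_fns" for \<phi>
    using assms that by (simp add: distributions_def)
  ultimately show ?thesis
    using dist_add[OF assms(1)] dist_add[OF assms(2)] dist_cmult[OF assms(1)] dist_cmult[OF assms(2)]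
    unfolding distributions_def mem_Collect_eq
    by (simp add: right_diff_distrib) (intro exI[of _ "C + D"] exI[of _ "max m n"], auto)
qed

lemma integrable_bounded_test:
  assumes "f \<in> borel_measurable torus" "\<And>x. \<bar>f x\<bar> \<le> K" "\<phi> \<in> test_fns"
  shows "integrable torus (\<lambda>x. f x * \<phi> x)"
proof -
  have c: "continuous_on UNIV \<phi>" using assms(3) by (rule test_fn_continuous)
  then have "bounded (\<phi> ` cbox 0 (\<chi> i. 2 * pi))"
    by (intro compact_imp_bounded compact_continuous_image compact_cbox) (rule continuous_on_subset, auto)
  then obtain B where B: "\<And>x. x \<in> cbox 0 (\<chi> i. 2 * pi) \<Longrightarrow> \<bar>\<phi> x\<bar> \<le> B"
    unfolding bounded_iff by auto
  show ?thesis
  proof (rule torus.integrable_const_bound)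
    show "AE x in torus. norm (f x * \<phi> x) \<le> K * B"
    proof (rule AE_I2)
      fix x assume "x \<in> space torus"
      then have "\<bar>\<phi> x\<bar> \<le> B" using B by simp
      then show "norm (f x * \<phi> x) \<le> K * B"
        using assms(2)[of x] by (simp add: abs_mult mult_mono)
    qed
    show "(\<lambda>x. f x * \<phi> x) \<in> borel_measurable torus"
      using assms(1) measurable_torus[OF borel_measurable_continuous_onI[OF c]] by (rule borel_measurable_times)
  qed
qed

lemma dist_of_distributions:
  assumes f: "f \<in> borel_measurable torus" "\<And>x. \<bar>f x\<bar> \<le> K"
  shows "dist_of f \<in> distributions"
proof -
  note int = integrable_bounded_test[OF f]
  have bd: "\<bar>dist_of f \<phi>\<bar> \<le> (K * measure torus (space torus)) * B"
    if "\<phi> \<in> test_fns" "\<forall>is x. length is \<le> 0 \<longrightarrow> \<bar>partials is \<phi> x\<bar> \<le> B" for \<phi> B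
  proof -
    have "\<bar>\<phi> x\<bar> \<le> B" for x using that(2)[rule_format, of "[]"] by simp
    then have le: "norm (f x * \<phi> x) \<le> K * B" for x
      using f(2)[of x] by (simp add: abs_mult mult_mono)
    have "\<bar>dist_of f \<phi>\<bar> \<le> (\<integral>x. norm (f x * \<phi> x) \<partial>torus)"
      using that(1) integral_norm_bound[of torus "\<lambda>x. f x * \<phi> x"] by (simp add: dist_of_def)
    also have "\<dots> \<le> (\<integral>x. K * B \<partial>torus)"
      using int[OF that(1)] le by (intro integral_mono) auto
    finally show ?thesis by (simp add: mult_ac)
  qed
  show ?thesis
    unfolding distributions_def mem_Collect_eq
  proof (intro conjI ballI allI impI)
    show "\<exists>C m. \<forall>\<phi>\<in>test_fns. \<forall>B. (\<forall>is x. length is \<le> m \<longrightarrow> \<bar>partials is \<phi> x\<bar> \<le> B) \<longrightarrow> \<bar>dist_of f \<phi>\<bar> \<le> C * B"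
      using bd by blast
    show "dist_of f (\<lambda>x. \<phi> x + \<psi> x) = dist_of f \<phi> + dist_of f \<psi>" if "\<phi> \<in> test_fns" "\<psi> \<in> test_fns" for \<phi> \<psi>
      using test_fn_add[OF that] that by (simp add: dist_of_def distrib_left int)
    show "dist_of f (\<lambda>x. a * \<phi> x) = a * dist_of f \<phi>" if "\<phi> \<in> test_fns" for \<phi> a
      using test_fn_cmult[OF that] that by (simp add: dist_of_def mult.left_commute)
  qed (simp add: dist_of_def)
qed

lemma dcoeff_dist_of:
  assumes f: "f \<in> borel_measurable torus" "\<And>x. \<bar>f x\<bar> \<le> K"
  shows "dcoeff (dist_of f) k = fcoeff f k"
proof -
  have int: "integrable torus (\<lambda>x. complex_of_real (f x) * cis (- (freq k \<bullet> x)))"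
    by (rule integrable_torus_bounded[of _ K])
       (use f in \<open>auto simp: norm_mult intro!: borel_measurable_times borel_measurable_of_real\<close>)
  have "(\<integral>x. f x * cos_mode k x \<partial>torus) = Re (\<integral>x. complex_of_real (f x) * cis (- (freq k \<bullet> x)) \<partial>torus)"
    "- (\<integral>x. f x * sin_mode k x \<partial>torus) = Im (\<integral>x. complex_of_real (f x) * cis (- (freq k \<bullet> x)) \<partial>torus)"
    using Bochner_Integration.integral_Re[OF int] Bochner_Integration.integral_Im[OF int] by simp_all
  then show ?thesis
    by (simp add: dcoeff_def dist_of_def cos_mode_test_fn sin_mode_test_fn fcoeff_def)
qed

lemma dcoeff_add: "dcoeff (u + v) k = dcoeff u k + dcoeff v k"
  and dcoeff_diff: "dcoeff (u - v) k = dcoeff u k - dcoeff v k"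
  and dcoeff_zero: "dcoeff 0 k = 0"
  by (simp_all add: dcoeff_def complex_eq_iff add_divide_distrib diff_divide_distrib)

lemma dcoeff_reflect:
  assumes "u \<in> distributions"
  shows "dcoeff u (- k) = cnj (dcoeff u k)"
  using dist_cmult[OF assms sin_mode_test_fn, of "- 1" k]
  by (simp add: dcoeff_def freq_uminus complex_eq_iff)

text \<open>Each mode has only the two Fourier coefficients at $\pm k$, so an even multiplier acts on it by a scalar and the
defining infinite series is a finite sum.\<close>

lemma fmult_trig:
  assumes "m (- k) = m k"
  shows "fmult m (cos_mode k) = (\<lambda>x. m k * cos_mode k x)" "fmult m (sin_mode k) = (\<lambda>x. m k * sin_mode k x)"
proof -
  have dist: "A * (of_bool P * a + of_bool Q * b) * B = (if P then A * a * B else 0) + (if Q then A * b * B else 0)"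
    for A a b B :: complex and P Q
    by (simp add: algebra_simps)
  have fin: "(\<Sum>\<^sub>\<infinity>j. of_real (m j) * (of_bool (j = k) * a + of_bool (j = - k) * b) * cis (freq j \<bullet> x)) =
      of_real (m k) * (a * cis (freq k \<bullet> x) + b * cis (- (freq k \<bullet> x)))" for a b x
  proof -
    have "(\<Sum>\<^sub>\<infinity>j. of_real (m j) * (of_bool (j = k) * a + of_bool (j = - k) * b) * cis (freq j \<bullet> x)) =
       (\<Sum>\<^sub>\<infinity>j\<in>{k, - k}. of_real (m j) * (of_bool (j = k) * a + of_bool (j = - k) * b) * cis (freq j \<bullet> x))"
      by (rule infsum_cong_neutral) auto
    also have "\<dots> = (\<Sum>j\<in>{k, - k}. of_real (m j) * (of_bool (j = k) * a + of_bool (j = - k) * b) * cis (freq j \<bullet> x))"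
      by simp
    also have "\<dots> = (\<Sum>j\<in>{k, - k}. if j = k then of_real (m j) * a * cis (freq j \<bullet> x) else 0) +
        (\<Sum>j\<in>{k, - k}. if j = - k then of_real (m j) * b * cis (freq j \<bullet> x) else 0)"
      unfolding sum.distrib[symmetric] dist ..
    also have "\<dots> = of_real (m k) * (a * cis (freq k \<bullet> x) + b * cis (- (freq k \<bullet> x)))"
      by (simp add: sum.delta assms freq_uminus algebra_simps)
    finally show ?thesis .
  qed
  show "fmult m (cos_mode k) = (\<lambda>x. m k * cos_mode k x)"
    using fin[of "1 / 2" "1 / 2"] by (simp add: fmult_def fcoeff_cos_mode fun_eq_iff)
  show "fmult m (sin_mode k) = (\<lambda>x. m k * sin_mode k x)"
  proof -
    have "fcoeff (sin_mode k) j = of_bool (j = k) * (1 / (2 * \<i>)) + of_bool (j = - k) * (- 1 / (2 * \<i>))" for j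
      by (simp add: fcoeff_sin_mode)
    then show ?thesis
      unfolding fmult_def by (simp only: fin) (simp add: fun_eq_iff Re_divide)
  qed
qed

lemma dcoeff_dmult:
  assumes "u \<in> distributions" "m (- k) = m k"
  shows "dcoeff (dmult m u) k = of_real (m k) * dcoeff u k"
  using dist_cmult[OF assms(1) cos_mode_test_fn] dist_cmult[OF assms(1) sin_mode_test_fn]
  by (simp add: dcoeff_def dmult_def cos_mode_test_fn sin_mode_test_fn fmult_trig[OF assms(2)] complex_eq_iff)

section \<open>Norms controlled by Fourier coefficients\<close>

lemma japanese_pos: "japanese s k > 0"
proof -
  have "1 + (norm (freq k))\<^sup>2 > 0" by (simp add: add_pos_nonneg)
  then show ?thesis by (simp add: japanese_def)
qed

lemma japanese_reflect: "japanese s (- k) = japanese s k"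
  by (simp add: japanese_def freq_uminus)

lemma Linf_norm_le:
  assumes "f \<in> borel_measurable torus" "\<And>x. \<bar>f x\<bar> \<le> B"
  shows "Linf_norm f \<le> ennreal B"
  unfolding Linf_norm_def using assms by (intro esssup_I) (auto intro!: ennreal_leI)

lemma AE_le_Linf_norm: "AE x in torus. ennreal \<bar>f x\<bar> \<le> Linf_norm f"
  unfolding Linf_norm_def by (rule esssup_AE)

lemma integrable_Linf:
  assumes "f \<in> borel_measurable torus" "Linf_norm f < \<top>"
  shows "integrable torus f"
proof (rule torus.integrable_const_bound)
  show "AE x in torus. norm (f x) \<le> enn2real (Linf_norm f)"
    using AE_le_Linf_norm[of f]
  proof eventually_elim
    case (elim x)
    then have "enn2real (ennreal \<bar>f x\<bar>) \<le> enn2real (Linf_norm f)"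
      using assms(2) by (intro enn2real_mono)
    then show ?case by simp
  qed
qed fact

lemma Linf_norm_diff:
  assumes "f \<in> borel_measurable torus" "g \<in> borel_measurable torus"
  shows "Linf_norm (\<lambda>x. f x - g x) \<le> Linf_norm f + Linf_norm g"
  unfolding Linf_norm_def[of "\<lambda>x. f x - g x"]
proof (rule esssup_I)
  show "AE x in torus. ennreal \<bar>f x - g x\<bar> \<le> Linf_norm f + Linf_norm g"
    using AE_le_Linf_norm[of f] AE_le_Linf_norm[of g]
  proof eventually_elim
    case (elim x)
    have "ennreal \<bar>f x - g x\<bar> \<le> ennreal \<bar>f x\<bar> + ennreal \<bar>g x\<bar>"
      by (simp add: abs_triangle_ineq4 ennreal_leI flip: ennreal_plus)
    also have "\<dots> \<le> Linf_norm f + Linf_norm g" using elim by (rule add_mono)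
    finally show ?case .
  qed
qed (use assms in measurable)

text \<open>The infimum in the norm need not be known to be attained, hence representing functions are chosen
up to an arbitrary error. They are bounded and therefore integrable, which makes their Fourier
coefficients additive.\<close>

lemma bessel_Linf_diff: "bessel_Linf s (u - v) \<le> bessel_Linf s u + bessel_Linf s v"
proof (cases "bessel_Linf s u < \<top> \<and> bessel_Linf s v < \<top>")
  case False
  then show ?thesis by (auto simp: not_less top_unique)
next
  case True
  show ?thesis
  proof (rule ennreal_le_epsilon)
    fix e :: real assume e: "0 < e"
    have ap: "\<exists>f. f \<in> borel_measurable torus \<and> (\<forall>k. fcoeff f k = of_real (japanese s k) * dcoeff w k) \<and>
        Linf_norm f < bessel_Linf s w + ennreal (e / 2)" if "bessel_Linf s w < \<top>" for w
      using INF_approx_ennreal[of "e / 2" "bessel_Linf s w", OF _ bessel_Linf_def] e that by auto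
    obtain f where f: "f \<in> borel_measurable torus" "\<And>k. fcoeff f k = of_real (japanese s k) * dcoeff u k"
        "Linf_norm f < bessel_Linf s u + ennreal (e / 2)" using ap True by blast
    obtain g where g: "g \<in> borel_measurable torus" "\<And>k. fcoeff g k = of_real (japanese s k) * dcoeff v k"
        "Linf_norm g < bessel_Linf s v + ennreal (e / 2)" using ap True by blast
    have i: "integrable torus f" "integrable torus g"
      using integrable_Linf f(1,3) g(1,3) top.not_eq_extremum by (metis order_less_imp_le less_le_trans top_greatest)+
    have "fcoeff (\<lambda>x. f x - g x) k = fcoeff f k - fcoeff g k" for k
      using fcoeff_add[of f "\<lambda>x. (- 1) * g x" k] fcoeff_cmult[of "- 1" g k] i by simp
    then have "fcoeff (\<lambda>x. f x - g x) k = of_real (japanese s k) * dcoeff (u - v) k" for k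
      by (simp add: f g dcoeff_diff right_diff_distrib)
    moreover have "(\<lambda>x. f x - g x) \<in> borel_measurable torus" using f g by measurable
    ultimately have "bessel_Linf s (u - v) \<le> Linf_norm (\<lambda>x. f x - g x)"
      unfolding bessel_Linf_def by (intro INF_lower) simp
    also have "\<dots> \<le> Linf_norm f + Linf_norm g" using f(1) g(1) by (rule Linf_norm_diff)
    also have "\<dots> \<le> (bessel_Linf s u + ennreal (e / 2)) + (bessel_Linf s v + ennreal (e / 2))"
      using f(3) g(3) by (intro add_mono) auto
    also have "\<dots> = bessel_Linf s u + bessel_Linf s v + (ennreal (e / 2) + ennreal (e / 2))"
      by (simp add: ac_simps)
    also have "ennreal (e / 2) + ennreal (e / 2) = ennreal e"
      using e by (subst ennreal_plus[symmetric]) auto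
    finally show "bessel_Linf s (u - v) \<le> bessel_Linf s u + bessel_Linf s v + ennreal e" .
  qed
qed

lemma C_norm_diff: "C_norm \<alpha> (u - v) \<le> C_norm \<alpha> u + C_norm \<alpha> v"
  unfolding C_norm_def fst_diff snd_diff
  by (intro max.boundedI order_trans[OF bessel_Linf_diff] add_mono) auto

text \<open>The elementary bound of a Fourier coefficient by the supremum of the function, applied to every
function that represents $(1-\Delta)^{s/2}u$.\<close>

lemma coeff_le_bessel_Linf: "ennreal (japanese s k * cmod (dcoeff u k)) \<le> bessel_Linf s u"
  unfolding bessel_Linf_def
proof (rule INF_greatest)
  fix f assume "f \<in> {f \<in> borel_measurable torus. \<forall>k. fcoeff f k = of_real (japanese s k) * dcoeff u k}"
  then have f: "f \<in> borel_measurable torus" "fcoeff f k = of_real (japanese s k) * dcoeff u k" by auto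
  show "ennreal (japanese s k * cmod (dcoeff u k)) \<le> Linf_norm f"
  proof (cases "Linf_norm f < \<top>")
    case True
    define L where "L = enn2real (Linf_norm f)"
    have L: "ennreal L = Linf_norm f" "L \<ge> 0" using True by (simp_all add: L_def)
    have i: "integrable torus (\<lambda>x. \<bar>f x\<bar>)" using integrable_Linf[OF f(1) True] by (rule integrable_abs)
    have "AE x in torus. \<bar>f x\<bar> \<le> L"
      using AE_le_Linf_norm[of f] by eventually_elim (simp add: L(2) flip: L(1))
    then have le: "(\<integral>x. \<bar>f x\<bar> \<partial>torus) \<le> (\<integral>x. L \<partial>torus)"
      using i by (intro integral_mono_AE) auto
    have m: "measure torus (cbox 0 (\<chi> i. 2 * pi)) = (2 * pi) ^ 3"
    proof -
      have "complex_of_real (measure torus (space torus)) = of_real ((2 * pi) ^ 3)"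
        using integral_character[of 0] by (simp add: freq_zero scaleR_conv_of_real del: space_torus)
      then show ?thesis by (simp only: of_real_eq_iff space_torus)
    qed
    have "japanese s k * cmod (dcoeff u k) = cmod (fcoeff f k)"
      using japanese_pos[of s k] by (simp add: f norm_mult)
    also have "\<dots> = cmod (\<integral>x. complex_of_real (f x) * cis (- (freq k \<bullet> x)) \<partial>torus) / (2 * pi) ^ 3"
      by (simp add: fcoeff_def norm_divide norm_power norm_mult)
    also have "\<dots> \<le> (\<integral>x. cmod (complex_of_real (f x) * cis (- (freq k \<bullet> x))) \<partial>torus) / (2 * pi) ^ 3"
      by (intro divide_right_mono integral_norm_bound) simp
    also have "\<dots> \<le> (\<integral>x. L \<partial>torus) / (2 * pi) ^ 3"
      using le by (intro divide_right_mono) (simp_all add: norm_mult)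
    also have "\<dots> = L" by (simp add: m)
    finally show ?thesis unfolding L(1)[symmetric] by (rule ennreal_leI)
  qed (auto simp: not_less top_unique)
qed

text \<open>The sum of an absolutely convergent Fourier series is one of the functions over which the infimum
is taken.\<close>

lemma bessel_Linf_le:
  assumes sym: "\<And>k. dcoeff u (- k) = cnj (dcoeff u k)"
  shows "bessel_Linf s u \<le> (\<integral>\<^sup>+k. ennreal (japanese s k * cmod (dcoeff u k)) \<partial>count_space UNIV)" (is "_ \<le> ?I")
proof (cases "?I < \<infinity>")
  case True
  let ?c = "\<lambda>k. of_real (japanese s k) * dcoeff u k"
  have nrm: "cmod (?c k) = japanese s k * cmod (dcoeff u k)" for k
    using japanese_pos[of s k] by (simp add: norm_mult)
  have int: "integrable (count_space UNIV) ?c"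
    by (rule integrableI_bounded) (use True in \<open>simp_all only: nrm, simp\<close>)
  obtain f where f: "f \<in> borel_measurable torus"
    "\<And>x. \<bar>f x\<bar> \<le> (\<integral>k. cmod (?c k) \<partial>count_space UNIV)" "\<And>k. fcoeff f k = ?c k"
    using Wiener_algebra_function[OF int] by (auto simp: japanese_reflect sym)
  have "bessel_Linf s u \<le> Linf_norm f"
    unfolding bessel_Linf_def using f(1,3) by (intro INF_lower) simp
  also have "\<dots> \<le> ennreal (\<integral>k. cmod (?c k) \<partial>count_space UNIV)"
    by (rule Linf_norm_le[OF f(1,2)])
  also have "\<dots> = (\<integral>\<^sup>+k. ennreal (cmod (?c k)) \<partial>count_space UNIV)"
    by (rule nn_integral_eq_integral[symmetric]) (use int in \<open>auto\<close>)
  finally show ?thesis by (simp only: nrm)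
qed (auto simp: not_less top_unique)

definition coeff_weight :: "real \<Rightarrow> dpair \<Rightarrow> int^3 \<Rightarrow> real" where
  "coeff_weight \<alpha> u k = japanese \<alpha> k * cmod (dcoeff (fst u) k) + japanese (\<alpha> - 2) k * cmod (dcoeff (snd u) k)"

text \<open>The norm of the Wiener algebra, transported to the scale of pairs with regularity $\alpha$.\<close>

definition wiener_norm :: "real \<Rightarrow> dpair \<Rightarrow> ennreal" where
  "wiener_norm \<alpha> u = (\<integral>\<^sup>+k. ennreal (coeff_weight \<alpha> u k) \<partial>count_space UNIV)"

lemma coeff_weight_nonneg: "coeff_weight \<alpha> u k \<ge> 0"
  unfolding coeff_weight_def using japanese_pos less_imp_le by (intro add_nonneg_nonneg mult_nonneg_nonneg) auto

text \<open>The coefficient symmetry of real distributions. It is used instead of membership in the space of distributions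
because it passes to \<open>S t u\<close> directly through the evenness of the symbols.\<close>

definition hermitian :: "dpair \<Rightarrow> bool" where
  "hermitian u \<longleftrightarrow> (\<forall>k. dcoeff (fst u) (- k) = cnj (dcoeff (fst u) k) \<and> dcoeff (snd u) (- k) = cnj (dcoeff (snd u) k))"

lemma C_norm_le_wiener_norm:
  assumes "hermitian u"
  shows "C_norm \<alpha> u \<le> wiener_norm \<alpha> u"
  unfolding C_norm_def wiener_norm_def
proof (intro max.boundedI)
  have j: "0 \<le> japanese s k * cmod z" for s k z using japanese_pos[of s k] by simp
  show "bessel_Linf \<alpha> (fst u) \<le> (\<integral>\<^sup>+k. ennreal (coeff_weight \<alpha> u k) \<partial>count_space UNIV)"
    using assms unfolding hermitian_def coeff_weight_def
    by (intro order_trans[OF bessel_Linf_le] nn_integral_mono ennreal_leI) (simp_all add: j)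
  show "bessel_Linf (\<alpha> - 2) (snd u) \<le> (\<integral>\<^sup>+k. ennreal (coeff_weight \<alpha> u k) \<partial>count_space UNIV)"
    using assms unfolding hermitian_def coeff_weight_def
    by (intro order_trans[OF bessel_Linf_le] nn_integral_mono ennreal_leI) (simp_all add: j)
qed

section \<open>The propagator in Fourier variables\<close>

lemma symbol_reflect:
  "s11 t (- k) = s11 t k" "s12 t (- k) = s12 t k" "s21 t (- k) = s21 t k" "s22 t (- k) = s22 t k"
  by (simp_all add: s11_def s12_def s21_def s22_def beam_freq_def freq_uminus)

lemma dcoeff_S:
  assumes "u \<in> distributions \<times> distributions"
  shows "dcoeff (fst (S t u)) k = s11 t k * dcoeff (fst u) k + s12 t k * dcoeff (snd u) k"
    "dcoeff (snd (S t u)) k = s21 t k * dcoeff (fst u) k + s22 t k * dcoeff (snd u) k"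
proof -
  have "fst u \<in> distributions" "snd u \<in> distributions" using assms by (auto simp: mem_Times_iff)
  then show "dcoeff (fst (S t u)) k = s11 t k * dcoeff (fst u) k + s12 t k * dcoeff (snd u) k"
    "dcoeff (snd (S t u)) k = s21 t k * dcoeff (fst u) k + s22 t k * dcoeff (snd u) k"
    by (simp_all add: S_def dcoeff_add dcoeff_dmult symbol_reflect)
qed

lemma hermitian_distributions: "u \<in> distributions \<times> distributions \<Longrightarrow> hermitian u"
  by (auto simp: hermitian_def dcoeff_reflect mem_Times_iff)

lemma hermitian_S: "u \<in> distributions \<times> distributions \<Longrightarrow> hermitian (S t u)"
  using hermitian_distributions[of u] by (simp add: hermitian_def dcoeff_S symbol_reflect)

lemma hermitian_diff: "hermitian u \<Longrightarrow> hermitian v \<Longrightarrow> hermitian (u - v)"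
  by (simp add: hermitian_def dcoeff_diff)

lemma S_diff: "S t (u - v) = S t u - S t v"
  by (auto simp: S_def dmult_def fun_eq_iff prod_eq_iff)

text \<open>With \<open>beam_freq_upper\<close> this says that $\omega_k$ is comparable to $1+|k|^2$, so one time
derivative costs as much as two space derivatives.\<close>

lemma beam_freq_lower: "1 + (norm (freq k))\<^sup>2 \<le> 2 * beam_freq k"
proof -
  have "(1 + (norm (freq k))\<^sup>2)\<^sup>2 \<le> (2 * beam_freq k)\<^sup>2"
    using beam_freq_sq[of k] sum_squares_ge_zero[of "3 * (norm (freq k))\<^sup>2 - 1" 0]
    by (simp add: power2_eq_square power4_eq_xxxx algebra_simps)
  then show ?thesis by (rule power2_le_imp_le) (use beam_freq_pos[of k] in simp)
qed

lemma beam_freq_upper: "beam_freq k \<le> 1 + (norm (freq k))\<^sup>2"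
  by (rule power2_le_imp_le) (use beam_freq_sq[of k] in \<open>simp_all add: power2_eq_square power4_eq_xxxx algebra_simps\<close>)

lemma symbol_bounds:
  "\<bar>s11 t k\<bar> \<le> 2 * exp (- t / 2)" "\<bar>s12 t k\<bar> * (1 + (norm (freq k))\<^sup>2) \<le> 2 * exp (- t / 2)"
  "\<bar>s21 t k\<bar> \<le> 2 * exp (- t / 2) * (1 + (norm (freq k))\<^sup>2)" "\<bar>s22 t k\<bar> \<le> 2 * exp (- t / 2)"
proof -
  let ?w = "beam_freq k" and ?q = "1 + (norm (freq k))\<^sup>2"
  have w: "?w > 0" "?q \<le> 2 * ?w" "?w \<le> ?q" "1 \<le> ?q"
    using beam_freq_pos beam_freq_lower beam_freq_upper by auto
  have s: "\<bar>sin (t * ?w)\<bar> \<le> 1" "\<bar>cos (t * ?w)\<bar> \<le> 1" by auto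
  have h: "\<bar>sin (t * ?w) / (2 * ?w)\<bar> \<le> 1"
  proof -
    have "\<bar>sin (t * ?w)\<bar> \<le> 2 * ?w" using w(2,4) s(1) by linarith
    then show ?thesis using w(1) by simp
  qed
  have a: "\<bar>cos (t * ?w) + sin (t * ?w) / (2 * ?w)\<bar> \<le> 2" "\<bar>cos (t * ?w) - sin (t * ?w) / (2 * ?w)\<bar> \<le> 2"
    using h s by linarith+
  show "\<bar>s11 t k\<bar> \<le> 2 * exp (- t / 2)" "\<bar>s22 t k\<bar> \<le> 2 * exp (- t / 2)"
    unfolding s11_def s22_def abs_mult using a by simp_all
  have b: "\<bar>sin (t * ?w) / ?w\<bar> * ?q \<le> 2"
  proof -
    have "\<bar>sin (t * ?w)\<bar> * ?q \<le> 1 * (2 * ?w)" using s w by (intro mult_mono) auto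
    then show ?thesis using w(1) by (simp add: pos_divide_le_eq)
  qed
  have "\<bar>s12 t k\<bar> * ?q = exp (- t / 2) * (\<bar>sin (t * ?w) / ?w\<bar> * ?q)"
    unfolding s12_def abs_mult by simp
  also have "\<dots> \<le> exp (- t / 2) * 2" using b by (intro mult_left_mono) auto
  finally show "\<bar>s12 t k\<bar> * ?q \<le> 2 * exp (- t / 2)" by simp
  have c: "(1 + norm (freq k) ^ 4) * \<bar>sin (t * ?w) / ?w\<bar> \<le> 2 * ?q"
  proof -
    have "(1 + norm (freq k) ^ 4) * \<bar>sin (t * ?w)\<bar> \<le> (1 + norm (freq k) ^ 4) * 1"
      using s by (intro mult_left_mono) auto
    also have "\<dots> \<le> 2 * (?w * ?w)"
    proof -
      have le: "(1 + y) * 1 \<le> 2 * (3 / 4 + y)" if "0 \<le> y" for y :: real using that by simp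
      show ?thesis unfolding beam_freq_sq by (rule le) simp
    qed
    also have "\<dots> \<le> 2 * (?q * ?w)" using w(1,3) by (intro mult_left_mono mult_right_mono) auto
    finally show ?thesis
      using w(1) by (simp only: abs_divide abs_of_pos times_divide_eq_right pos_divide_le_eq mult.assoc)
  qed
  have "\<bar>s21 t k\<bar> = exp (- t / 2) * ((1 + norm (freq k) ^ 4) * \<bar>sin (t * ?w) / ?w\<bar>)"
  proof -
    have "\<bar>- (1 + norm (freq k) ^ 4)\<bar> = 1 + norm (freq k) ^ 4"
      unfolding abs_minus_cancel by (rule abs_of_nonneg) simp
    then show ?thesis unfolding s21_def abs_mult by simp
  qed
  also have "\<dots> \<le> exp (- t / 2) * (2 * ?q)" using c by (intro mult_left_mono) auto
  finally show "\<bar>s21 t k\<bar> \<le> 2 * exp (- t / 2) * ?q" by (simp only: mult_ac)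
qed

lemma japanese_shift: "japanese s k = japanese (s - 2) k * (1 + (norm (freq k))\<^sup>2)"
proof -
  have "1 + (norm (freq k))\<^sup>2 > 0" by (simp add: add_pos_nonneg)
  then show ?thesis
    unfolding japanese_def by (simp add: diff_divide_distrib powr_diff)
qed

text \<open>The weights of the two components differ by the factor $1+|k|^2$, which is what the off-diagonal
symbols of the propagator gain and lose.\<close>

lemma coeff_weight_S:
  assumes "u \<in> distributions \<times> distributions"
  shows "coeff_weight \<alpha> (S t u) k \<le> 4 * exp (- t / 2) * coeff_weight \<alpha> u k"
proof -
  let ?q = "1 + (norm (freq k))\<^sup>2" and ?J = "japanese (\<alpha> - 2) k" and ?e = "2 * exp (- t / 2)"
  let ?a = "cmod (dcoeff (fst u) k)" and ?b = "cmod (dcoeff (snd u) k)"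
  have J: "?J > 0" "?q > 0" using japanese_pos by (auto simp: add_pos_nonneg)
  have "cmod (dcoeff (fst (S t u)) k) \<le> \<bar>s11 t k\<bar> * ?a + \<bar>s12 t k\<bar> * ?b"
    unfolding dcoeff_S[OF assms] by (rule norm_triangle_le) (simp add: norm_mult)
  then have "?q * cmod (dcoeff (fst (S t u)) k) \<le> ?q * (\<bar>s11 t k\<bar> * ?a + \<bar>s12 t k\<bar> * ?b)"
    using J by (intro mult_left_mono) auto
  also have "\<dots> = \<bar>s11 t k\<bar> * (?q * ?a) + (\<bar>s12 t k\<bar> * ?q) * ?b" by (simp add: algebra_simps)
  also have "\<dots> \<le> ?e * (?q * ?a) + ?e * ?b"
    using J by (intro add_mono mult_right_mono symbol_bounds mult_nonneg_nonneg) auto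
  finally have 1: "?q * cmod (dcoeff (fst (S t u)) k) \<le> ?e * (?q * ?a + ?b)" by (simp add: algebra_simps)
  have "cmod (dcoeff (snd (S t u)) k) \<le> \<bar>s21 t k\<bar> * ?a + \<bar>s22 t k\<bar> * ?b"
    unfolding dcoeff_S[OF assms] by (rule norm_triangle_le) (simp add: norm_mult)
  also have "\<dots> \<le> (?e * ?q) * ?a + ?e * ?b"
    by (intro add_mono mult_right_mono symbol_bounds) auto
  finally have 2: "cmod (dcoeff (snd (S t u)) k) \<le> ?e * (?q * ?a + ?b)" by (simp add: algebra_simps)
  have "coeff_weight \<alpha> (S t u) k = ?J * (?q * cmod (dcoeff (fst (S t u)) k) + cmod (dcoeff (snd (S t u)) k))"
    unfolding coeff_weight_def by (subst japanese_shift) (simp add: algebra_simps)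
  also have "\<dots> \<le> ?J * (2 * (?e * (?q * ?a + ?b)))"
    using 1 2 J by (intro mult_left_mono) linarith+
  also have "\<dots> = 4 * exp (- t / 2) * coeff_weight \<alpha> u k"
    unfolding coeff_weight_def by (subst (2) japanese_shift) (simp add: algebra_simps)
  finally show ?thesis .
qed

section \<open>Elements of the spaces of initial data\<close>

lemma C_norm_S_le:
  assumes "u \<in> distributions \<times> distributions"
  shows "C_norm \<alpha> (S t u) \<le> ennreal (4 * exp (- t / 2)) * wiener_norm \<alpha> u"
proof -
  have "C_norm \<alpha> (S t u) \<le> wiener_norm \<alpha> (S t u)"
    by (rule C_norm_le_wiener_norm[OF hermitian_S[OF assms]])
  also have "\<dots> \<le> (\<integral>\<^sup>+k. ennreal (4 * exp (- t / 2)) * ennreal (coeff_weight \<alpha> u k) \<partial>count_space UNIV)"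
    unfolding wiener_norm_def
    by (intro nn_integral_mono order_trans[OF ennreal_leI[OF coeff_weight_S[OF assms]]])
       (simp add: ennreal_mult coeff_weight_nonneg)
  also have "\<dots> = ennreal (4 * exp (- t / 2)) * wiener_norm \<alpha> u"
    unfolding wiener_norm_def by (rule nn_integral_cmult) simp
  finally show ?thesis .
qed

lemma X_norm_le_wiener_norm:
  assumes "u \<in> distributions \<times> distributions"
  shows "X_norm \<alpha> u \<le> 4 * wiener_norm \<alpha> u"
  unfolding X_norm_def
proof (rule SUP_least)
  fix t :: real assume t: "t \<in> {0..}"
  have "ennreal (exp (t / 8)) * C_norm \<alpha> (S t u)
      \<le> ennreal (exp (t / 8)) * (ennreal (4 * exp (- t / 2)) * wiener_norm \<alpha> u)"
    by (intro mult_left_mono C_norm_S_le assms) simp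
  also have "\<dots> = ennreal (4 * exp (t / 8 - t / 2)) * wiener_norm \<alpha> u"
  proof -
    have "4 * exp (t / 8 - t / 2) = exp (t / 8) * (4 * exp (- t / 2))"
      by (simp add: mult_exp_exp)
    then show ?thesis by (simp only: ennreal_mult exp_ge_zero mult.assoc zero_le_numeral mult_nonneg_nonneg)
  qed
  also have "\<dots> \<le> ennreal 4 * wiener_norm \<alpha> u"
    using t by (intro mult_right_mono ennreal_leI) auto
  finally show "ennreal (exp (t / 8)) * C_norm \<alpha> (S t u) \<le> 4 * wiener_norm \<alpha> u" by simp
qed

lemma continuous_symbols:
  "continuous_on A (\<lambda>t. s11 t k)" "continuous_on A (\<lambda>t. s12 t k)"
  "continuous_on A (\<lambda>t. s21 t k)" "continuous_on A (\<lambda>t. s22 t k)"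
  by (rule DERIV_continuous_on, rule has_field_derivative_at_within, rule propagator_symbol_ode)+

text \<open>Dominated convergence in the frequency variable: every symbol is continuous in time and the weights
are bounded uniformly in time.\<close>

lemma C_norm_S_continuous:
  assumes u: "u \<in> distributions \<times> distributions" and fin: "wiener_norm \<alpha> u < \<top>" and t: "t \<ge> 0"
  shows "((\<lambda>s. C_norm \<alpha> (S s u - S t u)) \<longlongrightarrow> 0) (at t within {0..})"
  unfolding tendsto_at_iff_sequentially o_def
proof (intro allI impI)
  fix X assume X: "\<forall>i. X i \<in> {0..} - {t}" "X \<longlonglongrightarrow> t"
  have "(\<lambda>n. \<integral>\<^sup>+k. ennreal (coeff_weight \<alpha> (S (X n) u - S t u) k) \<partial>count_space UNIV)
     \<longlonglongrightarrow> (\<integral>\<^sup>+k. 0 \<partial>count_space (UNIV :: (int^3) set))"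
  proof (rule nn_integral_dominated_convergence)
    show "(\<integral>\<^sup>+k. 8 * ennreal (coeff_weight \<alpha> u k) \<partial>count_space UNIV) < \<infinity>"
      using fin by (subst nn_integral_cmult) (auto simp: wiener_norm_def ennreal_mult_less_top)
    show "AE k in count_space UNIV. ennreal (coeff_weight \<alpha> (S (X n) u - S t u) k) \<le> 8 * ennreal (coeff_weight \<alpha> u k)" for n
    proof (rule AE_I2)
      fix k
      have tri: "coeff_weight \<alpha> (v - w) k \<le> coeff_weight \<alpha> v k + coeff_weight \<alpha> w k" for v w
      proof -
        have "japanese s k * cmod (a - b) \<le> japanese s k * cmod a + japanese s k * cmod b" for s a b
          using japanese_pos[of s k] norm_triangle_ineq4[of a b]
          by (metis distrib_left less_imp_le mult_left_mono)
        from this[of \<alpha> "dcoeff (fst v) k" "dcoeff (fst w) k"] this[of "\<alpha> - 2" "dcoeff (snd v) k" "dcoeff (snd w) k"]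
        show ?thesis unfolding coeff_weight_def fst_diff snd_diff dcoeff_diff by linarith
      qed
      have b: "coeff_weight \<alpha> (S r u) k \<le> 4 * coeff_weight \<alpha> u k" if "r \<ge> 0" for r
      proof -
        have "coeff_weight \<alpha> (S r u) k \<le> 4 * exp (- r / 2) * coeff_weight \<alpha> u k"
          by (rule coeff_weight_S[OF u])
        also have "\<dots> \<le> 4 * 1 * coeff_weight \<alpha> u k"
          using that by (intro mult_right_mono mult_left_mono coeff_weight_nonneg) auto
        finally show ?thesis by simp
      qed
      have "coeff_weight \<alpha> (S (X n) u - S t u) k \<le> 8 * coeff_weight \<alpha> u k"
        using tri[of "S (X n) u" "S t u"] b[of "X n"] b[of t] X(1) t by force
      then have "ennreal (coeff_weight \<alpha> (S (X n) u - S t u) k) \<le> ennreal (8 * coeff_weight \<alpha> u k)"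
        by (rule ennreal_leI)
      then show "ennreal (coeff_weight \<alpha> (S (X n) u - S t u) k) \<le> 8 * ennreal (coeff_weight \<alpha> u k)"
        by (simp add: ennreal_mult coeff_weight_nonneg)
    qed
    show "AE k in count_space UNIV. (\<lambda>n. ennreal (coeff_weight \<alpha> (S (X n) u - S t u) k)) \<longlonglongrightarrow> 0"
    proof (rule AE_I2)
      fix k
      have lim: "(\<lambda>n. s11 (X n) k) \<longlonglongrightarrow> s11 t k" "(\<lambda>n. s12 (X n) k) \<longlonglongrightarrow> s12 t k"
        "(\<lambda>n. s21 (X n) k) \<longlonglongrightarrow> s21 t k" "(\<lambda>n. s22 (X n) k) \<longlonglongrightarrow> s22 t k"
        using X(2) continuous_symbols[of UNIV k] by (auto simp: continuous_on_eq_continuous_at intro: isCont_tendsto_compose)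
      have "(\<lambda>n. coeff_weight \<alpha> (S (X n) u - S t u) k) \<longlonglongrightarrow>
        japanese \<alpha> k * cmod (dcoeff (fst (S t u)) k - dcoeff (fst (S t u)) k) +
        japanese (\<alpha> - 2) k * cmod (dcoeff (snd (S t u)) k - dcoeff (snd (S t u)) k)"
        unfolding coeff_weight_def fst_diff snd_diff dcoeff_diff dcoeff_S[OF u]
        by (intro tendsto_intros lim)
      then have "(\<lambda>n. coeff_weight \<alpha> (S (X n) u - S t u) k) \<longlonglongrightarrow> 0" by simp
      from tendsto_ennrealI[OF this]
      show "(\<lambda>n. ennreal (coeff_weight \<alpha> (S (X n) u - S t u) k)) \<longlonglongrightarrow> 0" by simp
    qed
  qed simp_all
  then have "(\<lambda>n. wiener_norm \<alpha> (S (X n) u - S t u)) \<longlonglongrightarrow> 0" by (simp add: wiener_norm_def)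
  then show "(\<lambda>n. C_norm \<alpha> (S (X n) u - S t u)) \<longlonglongrightarrow> 0"
    by (rule tendsto_sandwich[OF _ _ tendsto_const, rotated 2])
       (intro always_eventually allI zero_le C_norm_le_wiener_norm hermitian_diff hermitian_S u)+
qed

lemma wiener_norm_imp_Xbar:
  assumes u: "u \<in> distributions \<times> distributions" and fin: "wiener_norm \<alpha> u < \<top>"
  shows "u \<in> Xbar \<alpha>"
  unfolding Xbar_def
proof (intro CollectI conjI allI impI)
  show "C_norm \<alpha> (S t u) < \<top>" for t
    using C_norm_S_le[OF u, of \<alpha> t] fin by (simp add: ennreal_mult_less_top le_less_trans)
  show "X_norm \<alpha> u < \<top>"
    using X_norm_le_wiener_norm[OF u, of \<alpha>] fin by (simp add: ennreal_mult_less_top le_less_trans)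
qed (use u C_norm_S_continuous[OF u fin] in auto)

lemma trig_poly_bounded:
  fixes F :: "(int^3) set"
  shows "\<bar>\<Sum>k\<in>F. a k * cos_mode k x + b k * sin_mode k x\<bar> \<le> (\<Sum>k\<in>F. \<bar>a k\<bar> + \<bar>b k\<bar>)"
proof (rule order_trans[OF sum_abs sum_mono])
  fix k
  have "\<bar>a k * cos_mode k x\<bar> \<le> \<bar>a k\<bar> * 1" "\<bar>b k * sin_mode k x\<bar> \<le> \<bar>b k\<bar> * 1"
    unfolding abs_mult by (intro mult_left_mono; simp)+
  then show "\<bar>a k * cos_mode k x + b k * sin_mode k x\<bar> \<le> \<bar>a k\<bar> + \<bar>b k\<bar>" by linarith
qed

lemma trig_poly_measurable: "(\<lambda>x. \<Sum>k\<in>F. a k * cos_mode k x + b k * sin_mode k x) \<in> borel_measurable torus"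
  by measurable

lemma dcoeff_trig_poly:
  assumes "finite F"
  shows "dcoeff (dist_of (\<lambda>x. \<Sum>k\<in>F. a k * cos_mode k x + b k * sin_mode k x)) j =
    (\<Sum>k\<in>F. of_real (a k) * (of_bool (j = k) / 2 + of_bool (j = - k) / 2) +
      of_real (b k) * (of_bool (j = k) / (2 * \<i>) - of_bool (j = - k) / (2 * \<i>)))"
proof -
  have i: "integrable torus (\<lambda>x. a k * cos_mode k x)" "integrable torus (\<lambda>x. b k * sin_mode k x)" for k
    by (auto intro!: integrable_mult_right integrable_cos_mode integrable_sin_mode)
  show ?thesis
    by (subst dcoeff_dist_of[OF trig_poly_measurable trig_poly_bounded],
        subst fcoeff_sum[OF assms Bochner_Integration.integrable_add[OF i]])
       (simp only: fcoeff_add[OF i] fcoeff_cmult fcoeff_cos_mode fcoeff_sin_mode)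
qed

lemma trig_polysE:
  assumes "p \<in> trig_polys"
  obtains F a b where "finite F" "p = dist_of (\<lambda>x. \<Sum>k\<in>F. a k * cos_mode k x + b k * sin_mode k x)"
  using assms unfolding trig_polys_def by blast

lemma trig_polys_distributions: "p \<in> trig_polys \<Longrightarrow> p \<in> distributions"
  by (elim trig_polysE) (auto intro: dist_of_distributions[OF trig_poly_measurable trig_poly_bounded])

lemma trig_polys_finite_support: "p \<in> trig_polys \<Longrightarrow> finite {k. dcoeff p k \<noteq> 0}"
proof (elim trig_polysE)
  fix F a b assume F: "finite F" and p: "p = dist_of (\<lambda>x. \<Sum>k\<in>F. a k * cos_mode k x + b k * sin_mode k x)"
  have "dcoeff p k = 0" if "k \<notin> F \<union> uminus ` F" for k
    unfolding p dcoeff_trig_poly[OF F] using that by (intro sum.neutral ballI) (auto simp: of_bool_def image_iff)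
  then have "{k. dcoeff p k \<noteq> 0} \<subseteq> F \<union> uminus ` F" by blast
  then show "finite {k. dcoeff p k \<noteq> 0}" by (rule finite_subset) (simp add: F)
qed

lemma trig_polys_diff:
  assumes "p \<in> trig_polys" "q \<in> trig_polys"
  shows "p - q \<in> trig_polys"
proof -
  obtain F a b where p: "finite F" "p = dist_of (\<lambda>x. \<Sum>k\<in>F. a k * cos_mode k x + b k * sin_mode k x)"
    using assms(1) by (rule trig_polysE)
  obtain G c d where q: "finite G" "q = dist_of (\<lambda>x. \<Sum>k\<in>G. c k * cos_mode k x + d k * sin_mode k x)"
    using assms(2) by (rule trig_polysE)
  let ?e = "\<lambda>F a k. if k \<in> F then a k else (0 :: real)"
  have ext: "(\<Sum>k\<in>H. a k * cos_mode k x + b k * sin_mode k x) =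
      (\<Sum>k\<in>F \<union> G. ?e H a k * cos_mode k x + ?e H b k * sin_mode k x)" if "H \<subseteq> F \<union> G" for H a b x
    using that p(1) q(1) by (intro sum.mono_neutral_cong_left) auto
  let ?h = "\<lambda>x. \<Sum>k\<in>F \<union> G. (?e F a k - ?e G c k) * cos_mode k x + (?e F b k - ?e G d k) * sin_mode k x"
  have "(p - q) \<phi> = dist_of ?h \<phi>" for \<phi>
  proof (cases "\<phi> \<in> test_fns")
    case True
    have "?h x = (\<Sum>k\<in>F. a k * cos_mode k x + b k * sin_mode k x) - (\<Sum>k\<in>G. c k * cos_mode k x + d k * sin_mode k x)" for x
      unfolding ext[of F, OF Un_upper1] ext[of G, OF Un_upper2] sum_subtractf[symmetric]
      by (rule sum.cong) (auto simp: algebra_simps)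
    then show ?thesis
      using integrable_bounded_test[OF trig_poly_measurable trig_poly_bounded True]
      by (simp add: p q dist_of_def True left_diff_distrib)
  qed (simp add: p q dist_of_def)
  then have "p - q = dist_of ?h" ..
  then show ?thesis unfolding trig_polys_def using p(1) q(1)
    by (intro CollectI exI[of _ "F \<union> G"] exI[of _ "\<lambda>k. ?e F a k - ?e G c k"] exI[of _ "\<lambda>k. ?e F b k - ?e G d k"]) auto
qed

text \<open>Symmetry of the set of frequencies pairs the terms of the Fourier series at $k$ and $-k$, whose sum
is a real combination of the two modes.\<close>

lemma fourier_truncation:
  assumes u: "u \<in> distributions" and F: "finite F" "\<And>k. k \<in> F \<Longrightarrow> - k \<in> F"
  shows "\<exists>p\<in>trig_polys. \<forall>k. dcoeff p k = of_bool (k \<in> F) * dcoeff u k"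
proof (intro bexI allI)
  let ?p = "dist_of (\<lambda>x. \<Sum>k\<in>F. Re (dcoeff u k) * cos_mode k x + (- Im (dcoeff u k)) * sin_mode k x)"
  show "?p \<in> trig_polys" unfolding trig_polys_def using F(1)
    by (intro CollectI exI[of _ F] exI[of _ "\<lambda>k. Re (dcoeff u k)"] exI[of _ "\<lambda>k. - Im (dcoeff u k)"]) simp
  fix j
  have mem: "- j \<in> F \<longleftrightarrow> j \<in> F" using F(2)[of j] F(2)[of "- j"] by auto
  have alg: "of_real (Re z) * (of_bool P / 2 + of_bool Q / 2) + of_real (- Im z) * (of_bool P / (2 * \<i>) - of_bool Q / (2 * \<i>)) =
      (if P then z / 2 else 0) + (if Q then cnj z / 2 else 0)" for z P Q
    by (simp add: complex_eq_iff Re_divide Im_divide)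
  have swap: "j = - k \<longleftrightarrow> k = - j" for k by auto
  have "dcoeff ?p j = (\<Sum>k\<in>F. (if j = k then dcoeff u k / 2 else 0) + (if k = - j then cnj (dcoeff u k) / 2 else 0))"
    unfolding dcoeff_trig_poly[OF F(1)] alg unfolding swap ..
  also have "\<dots> = of_bool (j \<in> F) * (dcoeff u j / 2 + cnj (dcoeff u (- j)) / 2)"
    by (simp add: sum.distrib F(1) mem)
  finally show "dcoeff ?p j = of_bool (j \<in> F) * dcoeff u j"
    by (simp add: dcoeff_reflect[OF u])
qed

text \<open>The truncations to an increasing exhaustion by finite symmetric sets of frequencies
converge, since the tails of the weighted coefficient sum tend to 0.\<close>

lemma wiener_norm_imp_X_space:
  assumes u: "u \<in> distributions \<times> distributions" and fin: "wiener_norm \<alpha> u < \<top>"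
  shows "u \<in> X_space \<alpha>"
  unfolding X_space_def
proof (intro CollectI conjI allI impI)
  show "u \<in> Xbar \<alpha>" by (rule wiener_norm_imp_Xbar[OF assms])
  fix \<epsilon> :: ennreal assume \<epsilon>: "\<epsilon> > 0"
  define F where "F n = (\<lambda>i. from_nat_into (UNIV :: (int^3) set) i) ` {..<n} \<union> (\<lambda>i. - from_nat_into (UNIV :: (int^3) set) i) ` {..<n}" for n :: nat
  have F: "finite (F n)" "k \<in> F n \<Longrightarrow> - k \<in> F n" for n k
    unfolding F_def by auto
  have ev: "\<forall>\<^sub>F n in sequentially. k \<in> F n" for k
  proof -
    obtain i where i: "from_nat_into UNIV i = k"
      using from_nat_into_surj[OF countable_int3 UNIV_I[of k]] by blast
    have "k \<in> F n" if "n > i" for n using that i unfolding F_def by auto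
    then show ?thesis by (rule eventually_mono[OF eventually_gt_at_top[of i]])
  qed
  have "(\<lambda>n. \<integral>\<^sup>+k. ennreal (coeff_weight \<alpha> u k) * indicator (- F n) k \<partial>count_space UNIV)
    \<longlonglongrightarrow> (\<integral>\<^sup>+k. 0 \<partial>count_space (UNIV :: (int^3) set))"
  proof (rule nn_integral_dominated_convergence)
    show "(\<integral>\<^sup>+k. ennreal (coeff_weight \<alpha> u k) \<partial>count_space UNIV) < \<infinity>"
      using fin by (simp add: wiener_norm_def)
    show "AE k in count_space UNIV. (\<lambda>n. ennreal (coeff_weight \<alpha> u k) * indicator (- F n) k) \<longlonglongrightarrow> 0"
    proof (rule AE_I2)
      fix k show "(\<lambda>n. ennreal (coeff_weight \<alpha> u k) * indicator (- F n) k) \<longlonglongrightarrow> 0"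
        by (rule tendsto_eventually, rule eventually_mono[OF ev[of k]]) simp
    qed
    show "AE k in count_space UNIV. ennreal (coeff_weight \<alpha> u k) * indicator (- F n) k \<le> ennreal (coeff_weight \<alpha> u k)" for n
      by (rule AE_I2) (simp split: split_indicator)
  qed simp_all
  then have "(\<lambda>n. 4 * (\<integral>\<^sup>+k. ennreal (coeff_weight \<alpha> u k) * indicator (- F n) k \<partial>count_space UNIV)) \<longlonglongrightarrow> 4 * 0"
    by (intro ennreal_tendsto_cmult) simp_all
  then have "\<forall>\<^sub>F n in sequentially. 4 * (\<integral>\<^sup>+k. ennreal (coeff_weight \<alpha> u k) * indicator (- F n) k \<partial>count_space UNIV) < \<epsilon>"
    by (rule order_tendstoD(2)) (use \<epsilon> in simp)
  then obtain n where n: "4 * (\<integral>\<^sup>+k. ennreal (coeff_weight \<alpha> u k) * indicator (- F n) k \<partial>count_space UNIV) < \<epsilon>"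
    using eventually_happens trivial_limit_sequentially by blast
  have u12: "fst u \<in> distributions" "snd u \<in> distributions" using u by (auto simp: mem_Times_iff)
  obtain p where p: "p \<in> trig_polys" "\<And>k. dcoeff p k = of_bool (k \<in> F n) * dcoeff (fst u) k"
    using fourier_truncation[OF u12(1) F(1)[of n] F(2)[of _ n]] by auto
  obtain q where q: "q \<in> trig_polys" "\<And>k. dcoeff q k = of_bool (k \<in> F n) * dcoeff (snd u) k"
    using fourier_truncation[OF u12(2) F(1)[of n] F(2)[of _ n]] by auto
  have "u - (p, q) \<in> distributions \<times> distributions"
    using distributions_diff[OF u12(1) trig_polys_distributions[OF p(1)]]
      distributions_diff[OF u12(2) trig_polys_distributions[OF q(1)]]
    by (simp add: mem_Times_iff)
  then have "X_norm \<alpha> (u - (p, q)) \<le> 4 * wiener_norm \<alpha> (u - (p, q))" by (rule X_norm_le_wiener_norm)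
  also have "wiener_norm \<alpha> (u - (p, q)) = (\<integral>\<^sup>+k. ennreal (coeff_weight \<alpha> u k) * indicator (- F n) k \<partial>count_space UNIV)"
    unfolding wiener_norm_def
    by (rule nn_integral_cong) (simp add: coeff_weight_def dcoeff_diff p q indicator_def)
  finally have "X_norm \<alpha> (u - (p, q)) < \<epsilon>" using n by simp
  then show "\<exists>p\<in>trig_polys \<times> trig_polys. X_norm \<alpha> (u - p) < \<epsilon>" using p(1) q(1) by blast
qed

lemma X_norm_diff: "X_norm \<alpha> (u - v) \<le> X_norm \<alpha> u + X_norm \<alpha> v"
  unfolding X_norm_def[of \<alpha> "u - v"]
proof (rule SUP_least)
  fix t :: real assume t: "t \<in> {0..}"
  have "ennreal (exp (t / 8)) * C_norm \<alpha> (S t (u - v))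
      \<le> ennreal (exp (t / 8)) * (C_norm \<alpha> (S t u) + C_norm \<alpha> (S t v))"
    unfolding S_diff by (intro mult_left_mono C_norm_diff) simp
  also have "\<dots> \<le> X_norm \<alpha> u + X_norm \<alpha> v"
    unfolding distrib_left X_norm_def using t by (intro add_mono SUP_upper) auto
  finally show "ennreal (exp (t / 8)) * C_norm \<alpha> (S t (u - v)) \<le> X_norm \<alpha> u + X_norm \<alpha> v" .
qed

lemma Xbar_diff:
  assumes "u \<in> Xbar \<alpha>" "v \<in> Xbar \<alpha>"
  shows "u - v \<in> Xbar \<alpha>"
  unfolding Xbar_def
proof (intro CollectI conjI allI impI)
  show "u - v \<in> distributions \<times> distributions"
    using assms by (auto simp: Xbar_def intro: distributions_diff)
  show "C_norm \<alpha> (S t (u - v)) < \<top>" if "t \<ge> 0" for t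
  proof -
    have "C_norm \<alpha> (S t u) + C_norm \<alpha> (S t v) < \<top>" using assms that by (simp add: Xbar_def)
    then show ?thesis unfolding S_diff using C_norm_diff by (rule le_less_trans[rotated])
  qed
  show "X_norm \<alpha> (u - v) < \<top>"
    using assms le_less_trans[OF X_norm_diff, of \<alpha> u v \<top>] by (simp add: Xbar_def)
  fix t :: real assume t: "t \<ge> 0"
  have "((\<lambda>s. C_norm \<alpha> (S s u - S t u) + C_norm \<alpha> (S s v - S t v)) \<longlongrightarrow> 0 + 0) (at t within {0..})"
    using assms t by (intro tendsto_add) (auto simp: Xbar_def)
  then have lim: "((\<lambda>s. C_norm \<alpha> (S s u - S t u) + C_norm \<alpha> (S s v - S t v)) \<longlongrightarrow> 0) (at t within {0..})" by simp
  have "C_norm \<alpha> (S s (u - v) - S t (u - v)) \<le> C_norm \<alpha> (S s u - S t u) + C_norm \<alpha> (S s v - S t v)" for s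
  proof -
    have "S s (u - v) - S t (u - v) = (S s u - S t u) - (S s v - S t v)"
      unfolding S_diff by simp
    then show ?thesis using C_norm_diff by simp
  qed
  then show "((\<lambda>s. C_norm \<alpha> (S s (u - v) - S t (u - v))) \<longlongrightarrow> 0) (at t within {0..})"
    by (intro tendsto_sandwich[OF _ _ tendsto_const lim] always_eventually allI zero_le)
qed

lemma X_space_diff:
  assumes "u \<in> X_space \<alpha>" "v \<in> X_space \<alpha>"
  shows "u - v \<in> X_space \<alpha>"
  unfolding X_space_def
proof (intro CollectI conjI allI impI)
  show "u - v \<in> Xbar \<alpha>" using assms by (intro Xbar_diff) (auto simp: X_space_def)
  fix \<epsilon> :: ennreal assume "\<epsilon> > 0"
  then have e: "\<epsilon> / 2 > 0" by (simp add: ennreal_zero_less_divide)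
  obtain p where p: "p \<in> trig_polys \<times> trig_polys" "X_norm \<alpha> (u - p) < \<epsilon> / 2"
    using assms(1) e by (auto simp: X_space_def)
  obtain q where q: "q \<in> trig_polys \<times> trig_polys" "X_norm \<alpha> (v - q) < \<epsilon> / 2"
    using assms(2) e by (auto simp: X_space_def)
  have "u - v - (p - q) = (u - p) - (v - q)" by simp
  then have "X_norm \<alpha> (u - v - (p - q)) \<le> X_norm \<alpha> (u - p) + X_norm \<alpha> (v - q)" by (metis X_norm_diff)
  also have "\<dots> < \<epsilon> / 2 + \<epsilon> / 2" using p(2) q(2) by (rule add_strict_mono)
  also have "\<dots> = \<epsilon>"
    using add_divide_distrib_ennreal[of \<epsilon> \<epsilon> 2] mult_divide_eq_ennreal[of 2 \<epsilon>]
    by (simp add: mult_2_right)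
  finally have "X_norm \<alpha> (u - v - (p - q)) < \<epsilon>" .
  moreover have "p - q \<in> trig_polys \<times> trig_polys"
    using p(1) q(1) by (simp add: mem_Times_iff trig_polys_diff)
  ultimately show "\<exists>p\<in>trig_polys \<times> trig_polys. X_norm \<alpha> (u - v - p) < \<epsilon>" by (rule bexI)
qed

lemma trig_polys_X_space:
  assumes "p \<in> trig_polys \<times> trig_polys"
  shows "p \<in> X_space \<alpha>"
proof (rule wiener_norm_imp_X_space)
  have p: "fst p \<in> trig_polys" "snd p \<in> trig_polys" using assms by (auto simp: mem_Times_iff)
  then show "p \<in> distributions \<times> distributions" by (auto simp: mem_Times_iff trig_polys_distributions)
  let ?F = "{k. dcoeff (fst p) k \<noteq> 0} \<union> {k. dcoeff (snd p) k \<noteq> 0}"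
  have "wiener_norm \<alpha> p = (\<Sum>k\<in>?F. ennreal (coeff_weight \<alpha> p k))"
    unfolding wiener_norm_def
    using trig_polys_finite_support[OF p(1)] trig_polys_finite_support[OF p(2)]
    by (intro nn_integral_count_space') (auto simp: coeff_weight_def)
  then show "wiener_norm \<alpha> p < \<top>" by (simp add: sum_ennreal coeff_weight_nonneg)
qed

section \<open>Decay along a lacunary sequence of frequencies\<close>

definition lacunary :: "nat \<Rightarrow> int^3" where
  "lacunary m = axis 1 (2 ^ m)"

text \<open>The weight $2^m$ lies between the size $4^{-m}$ of the coefficients of the noise and the size
$2^{-\alpha m}$ that $X^\alpha$ permits. Frequencies are lacunary so that a coefficient of size
$2^{-m}$ at each of them is compatible with absolute convergence.\<close>

definition decaying :: "dist \<Rightarrow> bool" where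
  "decaying u \<longleftrightarrow> (\<lambda>m. 2 ^ m * Re (dcoeff u (lacunary m))) \<longlonglongrightarrow> 0"

lemma norm_freq_lacunary: "norm (freq (lacunary m)) = 2 ^ m"
proof -
  have "freq (lacunary m) = 2 ^ m *\<^sub>R axis 1 1" by (auto simp: freq_def lacunary_def axis_def vec_eq_iff)
  then show ?thesis by (simp add: norm_axis_1)
qed

lemma inj_lacunary: "inj lacunary"
proof (rule injI)
  fix m n assume "lacunary m = lacunary n"
  then have "(2 :: real) ^ m = 2 ^ n" unfolding norm_freq_lacunary[symmetric] by (rule arg_cong)
  then show "m = n" by (rule power_inject_exp[THEN iffD1, rotated]) simp
qed

lemma decaying_add: "decaying u \<Longrightarrow> decaying v \<Longrightarrow> decaying (u + v)"
  unfolding decaying_def dcoeff_add plus_complex.sel distrib_left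
  using tendsto_add[of _ 0 sequentially _ 0] by simp

lemma decaying_diff: "decaying u \<Longrightarrow> decaying v \<Longrightarrow> decaying (u - v)"
  unfolding decaying_def dcoeff_diff minus_complex.sel right_diff_distrib
  using tendsto_diff[of _ 0 sequentially _ 0] by simp

lemma decaying_zero: "decaying 0"
  by (simp add: decaying_def dcoeff_zero)

lemma decaying_add_iff: "decaying v \<Longrightarrow> decaying (u + v) \<longleftrightarrow> decaying u"
  using decaying_add[of u v] decaying_diff[of "u + v" v] by auto

section \<open>Measurability of the decay condition\<close>

text \<open>The time $t = 0$ in the supremum suffices, because $S(0)$ preserves all Fourier coefficients.\<close>

lemma coeff_le_X_norm:
  assumes "u \<in> distributions \<times> distributions"
  shows "ennreal (japanese \<alpha> k * cmod (dcoeff (fst u) k)) \<le> X_norm \<alpha> u"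
proof -
  have "ennreal (japanese \<alpha> k * cmod (dcoeff (fst u) k)) = ennreal (japanese \<alpha> k * cmod (dcoeff (fst (S 0 u)) k))"
    by (simp add: dcoeff_S[OF assms] propagator_symbol_0)
  also have "\<dots> \<le> bessel_Linf \<alpha> (fst (S 0 u))" by (rule coeff_le_bessel_Linf)
  also have "\<dots> \<le> ennreal (exp (0 / 8)) * C_norm \<alpha> (S 0 u)" by (simp add: C_norm_def)
  also have "\<dots> \<le> X_norm \<alpha> u" unfolding X_norm_def by (rule SUP_upper) simp
  finally show ?thesis .
qed

lemma X_space_distributions: "u \<in> X_space \<alpha> \<Longrightarrow> u \<in> distributions \<times> distributions"
  by (simp add: X_space_def Xbar_def)

lemma borel_measurable_coeff:
  "(\<lambda>u. Re (dcoeff (fst u) k)) \<in> borel_measurable (X_borel \<alpha>)"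
proof (rule borel_measurableI)
  fix W :: "real set" assume W: "open W"
  have sub: "{U. openin (X_top \<alpha>) U} \<subseteq> Pow (X_space \<alpha>)"
    using openin_subset by (fastforce simp: topspace_X_top)
  let ?c = "\<lambda>u. Re (dcoeff (fst u) k)"
  have "openin (X_top \<alpha>) (?c -` W \<inter> X_space \<alpha>)"
    unfolding openin_X_top
  proof (intro conjI ballI)
    fix u assume u: "u \<in> ?c -` W \<inter> X_space \<alpha>"
    then obtain \<delta> where \<delta>: "\<delta> > 0" "\<And>y. dist y (?c u) < \<delta> \<Longrightarrow> y \<in> W"
      using W unfolding open_dist by (metis IntD1 vimageE)
    have J: "japanese \<alpha> k > 0" by (rule japanese_pos)
    have "w \<in> ?c -` W \<inter> X_space \<alpha>"
      if w: "w \<in> X_space \<alpha>" "X_norm \<alpha> (w - u) < ennreal (japanese \<alpha> k * \<delta>)" for w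
    proof -
      have "w - u \<in> distributions \<times> distributions"
        using u w by (intro X_space_distributions[of _ \<alpha>] X_space_diff) auto
      from le_less_trans[OF coeff_le_X_norm[OF this] w(2), of k]
      have "japanese \<alpha> k * cmod (dcoeff (fst (w - u)) k) < japanese \<alpha> k * \<delta>"
        using J \<delta>(1) by (subst (asm) ennreal_less_iff) auto
      then have "cmod (dcoeff (fst w) k - dcoeff (fst u) k) < \<delta>"
        using J by (simp add: dcoeff_diff)
      then have "\<bar>?c w - ?c u\<bar> < \<delta>"
        using abs_Re_le_cmod[of "dcoeff (fst w) k - dcoeff (fst u) k"] by simp
      then show ?thesis using \<delta>(2)[of "?c w"] w(1) by (simp add: dist_real_def)
    qed
    then show "\<exists>\<epsilon>>0. \<forall>w\<in>X_space \<alpha>. X_norm \<alpha> (w - u) < \<epsilon> \<longrightarrow> w \<in> ?c -` W \<inter> X_space \<alpha>"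
      using J \<delta>(1) by (intro exI[of _ "ennreal (japanese \<alpha> k * \<delta>)"]) (simp add: ennreal_less_zero_iff)
  qed simp
  then show "?c -` W \<inter> space (X_borel \<alpha>) \<in> sets (X_borel \<alpha>)"
    unfolding X_borel_def using sub by (simp add: space_measure_of sets_measure_of sigma_sets.Basic)
qed

text \<open>Convergence of a sequence of continuous functions to 0 is a Borel condition, here expressed by an
upper limit.\<close>

lemma decaying_bounded_measurable:
  "(\<lambda>u. of_bool (decaying (fst u))) \<in> bounded_measurable \<alpha>"
proof -
  have eq: "decaying v \<longleftrightarrow> limsup (\<lambda>m. ennreal \<bar>2 ^ m * Re (dcoeff v (lacunary m))\<bar>) = 0" for v
  proof
    assume "decaying v"
    then have "(\<lambda>m. ennreal \<bar>2 ^ m * Re (dcoeff v (lacunary m))\<bar>) \<longlonglongrightarrow> ennreal 0"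
      unfolding decaying_def by (intro tendsto_ennrealI tendsto_rabs_zero)
    then show "limsup (\<lambda>m. ennreal \<bar>2 ^ m * Re (dcoeff v (lacunary m))\<bar>) = 0"
      using lim_imp_Limsup by force
  next
    assume "limsup (\<lambda>m. ennreal \<bar>2 ^ m * Re (dcoeff v (lacunary m))\<bar>) = 0"
    then have "(\<lambda>m. ennreal \<bar>2 ^ m * Re (dcoeff v (lacunary m))\<bar>) \<longlonglongrightarrow> ennreal 0"
      using tendsto_0_if_Limsup_eq_0_ennreal by force
    then show "decaying v"
      unfolding decaying_def
      by (subst (asm) tendsto_ennreal_iff) (auto intro: tendsto_rabs_zero_cancel)
  qed
  have [measurable]: "(\<lambda>u. Re (dcoeff (fst u) k)) \<in> borel_measurable (X_borel \<alpha>)" for k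
    by (rule borel_measurable_coeff)
  have "(\<lambda>u. of_bool (decaying (fst u)) :: real) \<in> borel_measurable (X_borel \<alpha>)"
    unfolding eq by measurable
  then show ?thesis unfolding bounded_measurable_def by (auto intro!: exI[of _ 1])
qed

section \<open>Elements of \<open>H\<^sup>2\<close> and trigonometric polynomials decay\<close>

text \<open>Square summability of $(1+|k|^2)$ times the coefficients gives decay of order $4^{-m}$ along the sequence.\<close>

lemma decaying_H2:
  assumes "sobolev_sq 2 u < \<top>"
  shows "decaying u"
proof -
  define B where "B = enn2real (sobolev_sq 2 u)"
  have B: "(japanese 2 k * cmod (dcoeff u k))\<^sup>2 \<le> B" for k
  proof -
    have "ennreal ((japanese 2 k * cmod (dcoeff u k))\<^sup>2) =
       (\<integral>\<^sup>+j. ennreal ((japanese 2 j * cmod (dcoeff u j))\<^sup>2) * indicator {k} j \<partial>count_space UNIV)"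
      by simp
    also have "\<dots> \<le> sobolev_sq 2 u"
      unfolding sobolev_sq_def by (intro nn_integral_mono) (simp split: split_indicator)
    also have "\<dots> = ennreal B" using assms by (simp add: B_def)
    finally show ?thesis by (simp add: B_def)
  qed
  have bound: "norm (2 ^ m * Re (dcoeff u (lacunary m))) \<le> sqrt B * (1 / 2) ^ m" for m
  proof -
    have "(2 ^ m)\<^sup>2 \<le> japanese 2 (lacunary m)"
      by (simp add: japanese_def norm_freq_lacunary add_pos_nonneg)
    then have "(2 ^ m)\<^sup>2 * cmod (dcoeff u (lacunary m)) \<le> japanese 2 (lacunary m) * cmod (dcoeff u (lacunary m))"
      by (rule mult_right_mono) simp
    also have "\<dots> \<le> sqrt B" using B[of "lacunary m"] by (rule real_le_rsqrt)
    finally have "(2 ^ m)\<^sup>2 * \<bar>Re (dcoeff u (lacunary m))\<bar> \<le> sqrt B"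
      using abs_Re_le_cmod[of "dcoeff u (lacunary m)"] by (meson mult_left_mono order_trans zero_le_power2)
    then show ?thesis by (simp add: abs_mult power2_eq_square field_simps)
  qed
  have "(\<lambda>m. sqrt B * (1 / 2) ^ m) \<longlonglongrightarrow> sqrt B * 0"
    by (intro tendsto_mult tendsto_const LIMSEQ_power_zero) simp
  then have "(\<lambda>m. sqrt B * (1 / 2) ^ m) \<longlonglongrightarrow> 0" by simp
  then show ?thesis unfolding decaying_def
    by (rule Lim_null_comparison[OF always_eventually, rotated]) (rule allI, rule bound)
qed

text \<open>A solution of the mild equation takes its values in $\mathcal H^2$, and the default value of the
remainder is 0, so both cases of its definition give decay.\<close>

lemma remainder_decaying:
  assumes "t \<ge> 0"
  shows "decaying (fst (remainder z u0 t))"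
proof (cases "\<exists>!v. mild_solution z u0 v")
  case True
  then have "mild_solution z u0 (remainder z u0)" unfolding remainder_def by (simp add: theI')
  then have "H_norm_sq 2 (remainder z u0 t) < \<top>" using assms unfolding mild_solution_def by blast
  then have "sobolev_sq 2 (fst (remainder z u0 t)) < \<top>" by (simp add: H_norm_sq_def)
  then show ?thesis by (rule decaying_H2)
next
  case False
  then show ?thesis unfolding remainder_def by (simp add: decaying_zero)
qed

lemma decaying_S_trig_poly:
  assumes "p \<in> trig_polys \<times> trig_polys"
  shows "decaying (fst (S t p))"
proof -
  have p: "fst p \<in> trig_polys" "snd p \<in> trig_polys" using assms by (auto simp: mem_Times_iff)
  have d: "p \<in> distributions \<times> distributions" using p by (simp add: mem_Times_iff trig_polys_distributions)
  let ?F = "{k. dcoeff (fst p) k \<noteq> 0} \<union> {k. dcoeff (snd p) k \<noteq> 0}"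
  have "finite (lacunary -` ?F)"
    using trig_polys_finite_support[OF p(1)] trig_polys_finite_support[OF p(2)]
    by (intro finite_vimageI inj_lacunary) simp
  then obtain N where N: "\<forall>m\<in>lacunary -` ?F. m < N" using finite_nat_set_iff_bounded by blast
  have "\<forall>\<^sub>F m in sequentially. 2 ^ m * Re (dcoeff (fst (S t p)) (lacunary m)) = 0"
  proof (rule eventually_sequentiallyI)
    fix m assume "N \<le> m"
    then have "m \<notin> lacunary -` ?F" using N leD by blast
    then have "lacunary m \<notin> ?F" by (simp only: vimage_eq not_False_eq_True)
    then show "2 ^ m * Re (dcoeff (fst (S t p)) (lacunary m)) = 0" by (simp add: dcoeff_S[OF d])
  qed
  then show ?thesis unfolding decaying_def by (rule tendsto_eventually)
qed

section \<open>The stochastic convolution decays almost surely\<close>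

text \<open>Square integrability is a consequence of Gaussianity; with it the covariance identity is a genuine
second moment.\<close>

lemma white_noise_isometry:
  assumes \<xi>: "white_noise M \<xi>" and f: "f \<in> L2_spacetime"
  shows "\<xi> f \<in> borel_measurable M" "integrable M (\<lambda>\<omega>. (\<xi> f \<omega>)\<^sup>2)"
    "(\<integral>\<omega>. (\<xi> f \<omega>)\<^sup>2 \<partial>M) = (\<integral>z. (f z)\<^sup>2 \<partial>(lborel \<Otimes>\<^sub>M torus))"
proof -
  have "centered_gaussian M (\<lambda>\<omega>. \<Sum>g\<in>{f}. 1 * \<xi> g \<omega>)"
    using \<xi>[unfolded white_noise_def, THEN conjunct2, THEN conjunct1, rule_format, of "{f}" "\<lambda>_. 1"] f
    by simp
  then have g: "centered_gaussian M (\<xi> f)" by simp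
  then show m: "\<xi> f \<in> borel_measurable M" by (simp add: centered_gaussian_def)
  show "integrable M (\<lambda>\<omega>. (\<xi> f \<omega>)\<^sup>2)"
    using g unfolding centered_gaussian_def
  proof (elim conjE disjE exE)
    assume z: "AE \<omega> in M. \<xi> f \<omega> = 0"
    have "integrable M (\<lambda>\<omega>. (\<xi> f \<omega>)\<^sup>2) \<longleftrightarrow> integrable M (\<lambda>\<omega>. 0 :: real)"
      using z m by (intro integrable_cong_AE) auto
    then show ?thesis by simp
  next
    fix \<sigma> :: real assume s: "0 < \<sigma>" and d: "distributed M lborel (\<xi> f) (\<lambda>x. ennreal (normal_density 0 \<sigma> x))"
    have "integrable lborel (\<lambda>x. normal_density 0 \<sigma> x * x\<^sup>2)"
      using integrable.intros[OF normal_moment_even[OF s, of 0 1]] by simp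
    then show ?thesis
      using distributed_integrable[OF d, of "\<lambda>x. x\<^sup>2"] s by simp
  qed
  show "(\<integral>\<omega>. (\<xi> f \<omega>)\<^sup>2 \<partial>M) = (\<integral>z. (f z)\<^sup>2 \<partial>(lborel \<Otimes>\<^sub>M torus))"
    unfolding power2_eq_square
    by (rule \<xi>[unfolded white_noise_def, THEN conjunct2, THEN conjunct2, THEN bspec, THEN bspec, OF f f])
qed

text \<open>The expected sum of the squares is finite, so almost surely the sum is finite and its terms tend
to 0.\<close>

lemma AE_tendsto_zero_of_summable_second_moments:
  fixes Y :: "nat \<Rightarrow> 'w \<Rightarrow> real"
  assumes int: "\<And>m. integrable M (\<lambda>\<omega>. (Y m \<omega>)\<^sup>2)" and sm: "summable (\<lambda>m. \<integral>\<omega>. (Y m \<omega>)\<^sup>2 \<partial>M)"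
  shows "AE \<omega> in M. (\<lambda>m. Y m \<omega>) \<longlonglongrightarrow> 0"
proof -
  have "(\<integral>\<^sup>+\<omega>. (\<Sum>m. ennreal ((Y m \<omega>)\<^sup>2)) \<partial>M) = (\<Sum>m. \<integral>\<^sup>+\<omega>. ennreal ((Y m \<omega>)\<^sup>2) \<partial>M)"
    using int by (intro nn_integral_suminf) auto
  also have "\<dots> = (\<Sum>m. ennreal (\<integral>\<omega>. (Y m \<omega>)\<^sup>2 \<partial>M))"
    using int by (simp add: nn_integral_eq_integral)
  also have "\<dots> = ennreal (\<Sum>m. \<integral>\<omega>. (Y m \<omega>)\<^sup>2 \<partial>M)"
    using sm by (intro suminf_ennreal2) auto
  finally have "(\<integral>\<^sup>+\<omega>. (\<Sum>m. ennreal ((Y m \<omega>)\<^sup>2)) \<partial>M) \<noteq> \<infinity>" by simp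
  then have "AE \<omega> in M. (\<Sum>m. ennreal ((Y m \<omega>)\<^sup>2)) \<noteq> \<infinity>"
    using int by (intro nn_integral_noteq_infinite) auto
  then show ?thesis
  proof eventually_elim
    case (elim \<omega>)
    then have "summable (\<lambda>m. (Y m \<omega>)\<^sup>2)" by (intro summable_suminf_not_top) auto
    then have "(\<lambda>m. (Y m \<omega>)\<^sup>2) \<longlonglongrightarrow> 0" by (rule summable_LIMSEQ_zero)
    then show ?case by simp
  qed
qed

lemma power_power_swap: "((a :: 'a :: monoid_mult) ^ m) ^ n = (a ^ n) ^ m"
  by (simp only: power_mult[symmetric] mult.commute)

text \<open>The space-time function against which white noise is integrated to obtain the cosine coefficient of
$\theta_t$ at the frequency $k$, with the multiplier already evaluated.\<close>

definition wiener_integrand :: "real \<Rightarrow> int^3 \<Rightarrow> real \<times> (real^3) \<Rightarrow> real" where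
  "wiener_integrand t k = (\<lambda>(t', x). indicator {0..t} t' * (sqrt 2 * (s12 (t - t') k * cos_mode k x)))"

lemma wiener_integrand_eq:
  "(\<lambda>(t', x). indicator {0..t} t' * (sqrt 2 * fmult (s12 (t - t')) (cos_mode k) x)) = wiener_integrand t k"
  unfolding wiener_integrand_def by (subst fmult_trig(1)) (rule symbol_reflect, rule refl)

text \<open>The symbol $s_{12}$ is of order $(1+|k|^2)^{-1}$, so the squared norm, which is the
variance of the coefficient, is of order $(1+|k|^2)^{-2}$.\<close>

lemma wiener_integrand_L2:
  fixes t :: real and k :: "int^3"
  defines "A \<equiv> {0..t} \<times> (space torus)"
  shows "wiener_integrand t k \<in> L2_spacetime"
    "(\<integral>z. (wiener_integrand t k z)\<^sup>2 \<partial>(lborel \<Otimes>\<^sub>M torus))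
      \<le> 8 * measure (lborel \<Otimes>\<^sub>M torus) A / (1 + (norm (freq k))\<^sup>2)\<^sup>2"
proof -
  let ?P = "(lborel :: real measure) \<Otimes>\<^sub>M torus" and ?q = "1 + (norm (freq k))\<^sup>2"
  have q: "?q > 0" by (simp add: add_pos_nonneg)
  have [measurable]: "(\<lambda>t'. s12 (t - t') k) \<in> borel_measurable lborel"
    unfolding measurable_lborel2 s12_def
    using beam_freq_pos[of k] by (intro borel_measurable_continuous_onI continuous_intros) auto
  have meas: "wiener_integrand t k \<in> borel_measurable ?P"
    unfolding wiener_integrand_def by measurable
  have A: "A \<in> sets ?P" unfolding A_def by (intro pair_measureI) (simp_all add: sets.top del: space_torus)
  have "emeasure ?P A = emeasure lborel {0..t} * emeasure torus (space torus)"
    unfolding A_def by (rule torus.emeasure_pair_measure_Times) (simp_all del: space_torus)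
  also have "\<dots> < \<infinity>"
    using torus.emeasure_finite[of "space torus", unfolded less_top] emeasure_lborel_cbox_finite[of 0 t]
    by (simp add: ennreal_mult_less_top del: space_torus)
  finally have fin: "emeasure ?P A < \<infinity>" .
  have dom: "integrable ?P (\<lambda>z. (8 / ?q\<^sup>2) * indicator A z)"
    using A fin by (intro integrable_mult_right integrable_real_indicator)
  have bound: "(wiener_integrand t k z)\<^sup>2 \<le> (8 / ?q\<^sup>2) * indicator A z" if "z \<in> space ?P" for z
  proof (cases "fst z \<in> {0..t}")
    case True
    obtain t' x where z: "z = (t', x)" by (cases z)
    have inA: "z \<in> A" using that True by (simp add: A_def z space_pair_measure)
    have "\<bar>s12 (t - t') k\<bar> * ?q \<le> 2 * exp (- (t - t') / 2)" by (rule symbol_bounds)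
    also have "\<dots> \<le> 2 * 1" using True by (intro mult_left_mono) (auto simp: z)
    finally have s: "\<bar>s12 (t - t') k\<bar> \<le> 2 / ?q" using q by (simp only: pos_le_divide_eq)
    have "\<bar>s12 (t - t') k * cos_mode k x\<bar> \<le> (2 / ?q) * 1"
      unfolding abs_mult using s q by (intro mult_mono) auto
    then have "(s12 (t - t') k * cos_mode k x)\<^sup>2 \<le> (2 / ?q)\<^sup>2" by (intro abs_le_square_iff[THEN iffD1]) (use q in auto)
    then have "2 * (s12 (t - t') k * cos_mode k x)\<^sup>2 \<le> 8 / ?q\<^sup>2" by (simp add: power_divide)
    then show ?thesis using True inA by (simp add: wiener_integrand_def z power_mult_distrib)
  next
    case False
    then show ?thesis by (cases z) (simp add: wiener_integrand_def)
  qed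
  have int: "integrable ?P (\<lambda>z. (wiener_integrand t k z)\<^sup>2)"
    by (rule Bochner_Integration.integrable_bound[OF dom])
       (use meas bound in \<open>auto intro!: AE_I2 borel_measurable_power order_trans[OF bound abs_ge_self]\<close>)
  then show "wiener_integrand t k \<in> L2_spacetime" using meas by (simp add: L2_spacetime_def)
  have "(\<integral>z. (wiener_integrand t k z)\<^sup>2 \<partial>?P) \<le> (\<integral>z. (8 / ?q\<^sup>2) * indicator A z \<partial>?P)"
    by (rule integral_mono[OF int dom bound])
  also have "\<dots> = 8 * measure ?P A / ?q\<^sup>2"
    using A sets.sets_into_space[OF A] by (simp add: Int_absorb2)
  finally show "(\<integral>z. (wiener_integrand t k z)\<^sup>2 \<partial>?P) \<le> 8 * measure ?P A / ?q\<^sup>2" .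
qed

lemma stochastic_convolution_decaying:
  assumes \<xi>: "white_noise M \<xi>" and \<theta>: "stochastic_convolution M \<xi> \<theta>" and t: "t \<ge> 0"
  shows "AE \<omega> in M. decaying (fst (\<theta> t \<omega>))"
proof -
  define C where "C = 8 * measure (lborel \<Otimes>\<^sub>M torus) ({0..t} \<times> space torus)"
  define Y where "Y m \<omega> = 2 ^ m * \<xi> (wiener_integrand t (lacunary m)) \<omega>" for m \<omega>
  note iso = white_noise_isometry[OF \<xi> wiener_integrand_L2(1)]
  have sq: "(Y m \<omega>)\<^sup>2 = (2 ^ m)\<^sup>2 * (\<xi> (wiener_integrand t (lacunary m)) \<omega>)\<^sup>2" for m \<omega>
    by (simp add: Y_def power_mult_distrib)
  have int: "integrable M (\<lambda>\<omega>. (Y m \<omega>)\<^sup>2)" for m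
    unfolding sq by (intro integrable_mult_right iso)
  have bd: "(\<integral>\<omega>. (Y m \<omega>)\<^sup>2 \<partial>M) \<le> C * (1 / 4) ^ m" for m
  proof -
    have C: "C \<ge> 0" by (simp add: C_def)
    have "(\<integral>\<omega>. (Y m \<omega>)\<^sup>2 \<partial>M) = (2 ^ m)\<^sup>2 * (\<integral>z. (wiener_integrand t (lacunary m) z)\<^sup>2 \<partial>(lborel \<Otimes>\<^sub>M torus))"
      unfolding sq by (simp add: iso)
    also have "\<dots> \<le> (2 ^ m)\<^sup>2 * (C / (1 + (2 ^ m)\<^sup>2)\<^sup>2)"
      using wiener_integrand_L2(2)[of t "lacunary m"] unfolding C_def norm_freq_lacunary by (intro mult_left_mono) auto
    also have "\<dots> \<le> (2 ^ m)\<^sup>2 * (C / ((2 ^ m)\<^sup>2)\<^sup>2)"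
      using C by (intro mult_left_mono divide_left_mono power_mono mult_pos_pos zero_less_power) (auto simp: add_pos_nonneg)
    also have "\<dots> = C * (1 / 4) ^ m"
    proof -
      have "((2 :: real) ^ m)\<^sup>2 = 4 ^ m" by (subst power_power_swap) simp
      then show ?thesis by (simp add: power2_eq_square power_one_over)
    qed
    finally show ?thesis .
  qed
  have "summable (\<lambda>m. C * (1 / 4 :: real) ^ m)" by (intro summable_mult summable_geometric) simp
  then have "summable (\<lambda>m. \<integral>\<omega>. (Y m \<omega>)\<^sup>2 \<partial>M)"
    by (rule summable_comparison_test'[where N = 0]) (use bd in auto)
  then have "AE \<omega> in M. (\<lambda>m. Y m \<omega>) \<longlonglongrightarrow> 0"
    using int by (intro AE_tendsto_zero_of_summable_second_moments)
  moreover have "AE \<omega> in M. \<forall>m. fst (\<theta> t \<omega>) (cos_mode (lacunary m)) = \<xi> (wiener_integrand t (lacunary m)) \<omega>"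
    unfolding AE_all_countable
    using \<theta> t cos_mode_test_fn unfolding stochastic_convolution_def wiener_integrand_eq[symmetric] by blast
  ultimately show ?thesis
  proof eventually_elim
    case (elim \<omega>)
    have "(\<lambda>m. Y m \<omega> / (2 * pi) ^ 3) \<longlonglongrightarrow> 0 / (2 * pi) ^ 3"
      by (intro tendsto_divide elim tendsto_const) simp
    moreover have "Y m \<omega> / (2 * pi) ^ 3 = 2 ^ m * Re (dcoeff (fst (\<theta> t \<omega>)) (lacunary m))" for m
      using elim(2) by (simp add: Y_def dcoeff_def)
    ultimately have "(\<lambda>m. 2 ^ m * Re (dcoeff (fst (\<theta> t \<omega>)) (lacunary m))) \<longlonglongrightarrow> 0 / (2 * pi) ^ 3"
      by (simp only:)
    then show ?case by (simp add: decaying_def)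
  qed
qed

section \<open>The transition semigroup on the indicator function\<close>

text \<open>A zero-one statement: for a fixed datum the event that the flow decays agrees almost surely with a
deterministic condition. Its measurability comes from the completeness of the probability space.\<close>

lemma transition_decaying:
  assumes \<xi>: "white_noise M \<xi>" and \<theta>: "stochastic_convolution M \<xi> \<theta>" and t: "t \<ge> 0"
  shows "transition M \<theta> t (\<lambda>u. of_bool (decaying (fst u))) u = of_bool (decaying (fst (S t u)))"
proof -
  interpret prob_space M using \<xi> by (simp add: white_noise_def)
  interpret C: prob_space "completion M" by (rule prob_space_completion)
  let ?D = "\<lambda>\<omega>. decaying (fst (flow \<theta> t u \<omega>))"
  have ae: "AE \<omega> in M. ?D \<omega> \<longleftrightarrow> decaying (fst (S t u))"
    using stochastic_convolution_decaying[OF assms]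
  proof eventually_elim
    case (elim \<omega>)
    then show ?case
      using remainder_decaying[OF t] by (simp add: flow_def decaying_add_iff)
  qed
  have "Measurable.pred (completion M) ?D"
  proof (cases "decaying (fst (S t u))")
    case True
    then have "Measurable.pred (completion M) (\<lambda>\<omega>. \<not> ?D \<omega>)" using ae by (intro sets_completion_AE) simp
    then have "Measurable.pred (completion M) (\<lambda>\<omega>. \<not> \<not> ?D \<omega>)" by (rule pred_intros_logic)
    then show ?thesis by simp
  next
    case False
    then show ?thesis using ae by (intro sets_completion_AE) simp
  qed
  then have "(\<integral>\<omega>. of_bool (?D \<omega>) \<partial>completion M) = (\<integral>\<omega>. of_bool (decaying (fst (S t u))) \<partial>completion M :: real)"
    using AE_completion[OF ae] by (intro integral_cong_AE) auto
  then show ?thesis by (simp add: transition_def C.prob_space[simplified])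
qed

section \<open>A datum that does not decay\<close>

lemma beam_freq_lacunary: "beam_freq (lacunary m) = sqrt (3 / 4 + 16 ^ m)"
proof -
  have "((2 :: real) ^ m) ^ 4 = 16 ^ m" by (subst power_power_swap) simp
  then show ?thesis by (simp add: beam_freq_def norm_freq_lacunary)
qed

lemma beam_freq_lacunary_inverse: "(\<lambda>m. 1 / beam_freq (lacunary m)) \<longlonglongrightarrow> 0"
proof (rule Lim_null_comparison)
  show "\<forall>\<^sub>F m in sequentially. norm (1 / beam_freq (lacunary m)) \<le> (1 / 4) ^ m"
  proof (intro always_eventually allI)
    fix m
    have "sqrt (16 ^ m) \<le> beam_freq (lacunary m)" unfolding beam_freq_lacunary by simp
    moreover have "sqrt (16 ^ m) = 4 ^ m"
      by (rule real_sqrt_unique) (simp_all add: power_power_swap[of _ m])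
    ultimately have "4 ^ m \<le> beam_freq (lacunary m)" by simp
    then show "norm (1 / beam_freq (lacunary m)) \<le> (1 / 4) ^ m"
      using beam_freq_pos[of "lacunary m"] by (simp add: power_one_over frac_le)
  qed
  show "(\<lambda>m. (1 / 4 :: real) ^ m) \<longlonglongrightarrow> 0" by (rule LIMSEQ_power_zero) simp
qed

text \<open>The difference is $16\omega_m^2 - \omega_{m+1}^2$, which is constant in $m$, divided by the sum of
the two frequencies.\<close>

lemma beam_freq_lacunary_Suc: "(\<lambda>m. 4 * beam_freq (lacunary m) - beam_freq (lacunary (Suc m))) \<longlonglongrightarrow> 0"
proof (rule Lim_null_comparison)
  let ?b = "\<lambda>m. beam_freq (lacunary m)"
  show "\<forall>\<^sub>F m in sequentially. norm (4 * ?b m - ?b (Suc m)) \<le> 12 * (1 / ?b m)"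
  proof (intro always_eventually allI)
    fix m
    have p: "?b m > 0" "?b (Suc m) > 0" by (rule beam_freq_pos)+
    have sq: "?b n * ?b n = 3 / 4 + 16 ^ n" for n by (simp add: beam_freq_lacunary)
    have "(4 * ?b m - ?b (Suc m)) * (4 * ?b m + ?b (Suc m)) = 16 * (?b m * ?b m) - ?b (Suc m) * ?b (Suc m)"
      by (simp add: algebra_simps)
    also have "\<dots> = 45 / 4" unfolding sq by simp
    finally have prod: "(4 * ?b m - ?b (Suc m)) * (4 * ?b m + ?b (Suc m)) = 45 / 4" .
    have "4 * ?b m - ?b (Suc m) = (45 / 4) / (4 * ?b m + ?b (Suc m))"
      by (rule nonzero_eq_divide_eq[THEN iffD2, OF _ prod]) (use p in linarith)
    moreover have "(45 / 4) / (4 * ?b m + ?b (Suc m)) \<le> 12 / ?b m"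
      using p by (intro frac_le) auto
    moreover have "0 \<le> (45 / 4) / (4 * ?b m + ?b (Suc m))" using p by simp
    ultimately show "norm (4 * ?b m - ?b (Suc m)) \<le> 12 * (1 / ?b m)" by simp
  qed
  show "(\<lambda>m. 12 * (1 / ?b m)) \<longlonglongrightarrow> 0"
    using tendsto_mult[OF tendsto_const[of 12] beam_freq_lacunary_inverse] by simp
qed

text \<open>If the values tended to 0, so would $\cos(t\omega_m)$; quadrupling the angle would then make
$\cos(t\omega_{m+1})$ tend to 1.\<close>

lemma s11_lacunary_not_null: "\<not> (\<lambda>m. s11 t (lacunary m)) \<longlonglongrightarrow> 0"
proof
  let ?b = "\<lambda>m. beam_freq (lacunary m)"
  assume "(\<lambda>m. s11 t (lacunary m)) \<longlonglongrightarrow> 0"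
  then have "(\<lambda>m. exp (t / 2) * s11 t (lacunary m)) \<longlonglongrightarrow> exp (t / 2) * 0" by (intro tendsto_mult tendsto_const)
  moreover have "exp (t / 2) * s11 t (lacunary m) = cos (t * ?b m) + sin (t * ?b m) / (2 * ?b m)" for m
    unfolding s11_def mult.assoc[symmetric] mult_exp_exp by simp
  ultimately have 1: "(\<lambda>m. cos (t * ?b m) + sin (t * ?b m) / (2 * ?b m)) \<longlonglongrightarrow> 0" by simp
  have 2: "(\<lambda>m. sin (t * ?b m) / (2 * ?b m)) \<longlonglongrightarrow> 0"
  proof (rule Lim_null_comparison[OF _ beam_freq_lacunary_inverse], intro always_eventually allI)
    fix m
    show "norm (sin (t * ?b m) / (2 * ?b m)) \<le> 1 / ?b m"
      using beam_freq_pos[of "lacunary m"] abs_sin_le_one[of "t * ?b m"]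
      by (simp add: abs_mult frac_le)
  qed
  have c: "(\<lambda>m. cos (t * ?b m)) \<longlonglongrightarrow> 0" using tendsto_diff[OF 1 2] by simp
  have "(\<lambda>m. 2 * (2 * (cos (t * ?b m))\<^sup>2 - 1)\<^sup>2 - 1) \<longlonglongrightarrow> 2 * (2 * 0\<^sup>2 - 1)\<^sup>2 - 1"
    by (intro tendsto_intros c)
  moreover have "2 * (2 * (cos x)\<^sup>2 - 1)\<^sup>2 - 1 = cos (4 * x)" for x :: real
    using cos_double_cos[of x] cos_double_cos[of "2 * x"] by simp
  ultimately have 4: "(\<lambda>m. cos (4 * (t * ?b m))) \<longlonglongrightarrow> 1" by simp
  have lip: "\<bar>cos x - cos y\<bar> \<le> \<bar>x - y\<bar>" for x y :: real
  proof -
    have "\<bar>cos x - cos y\<bar> = 2 * (\<bar>sin ((x + y) / 2)\<bar> * \<bar>sin ((y - x) / 2)\<bar>)"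
      by (simp add: cos_diff_cos abs_mult)
    also have "\<dots> \<le> 2 * (1 * \<bar>(y - x) / 2\<bar>)"
      by (intro mult_left_mono mult_mono abs_sin_x_le_abs_x abs_sin_le_one) auto
    finally show ?thesis by (simp add: abs_minus_commute)
  qed
  have "(\<lambda>m. cos (4 * (t * ?b m)) - cos (t * ?b (Suc m))) \<longlonglongrightarrow> 0"
  proof (rule Lim_null_comparison)
    show "\<forall>\<^sub>F m in sequentially. norm (cos (4 * (t * ?b m)) - cos (t * ?b (Suc m)))
        \<le> \<bar>t * (4 * ?b m - ?b (Suc m))\<bar>"
      using lip[of "4 * (t * ?b m)" "t * ?b (Suc m)" for m]
      by (intro always_eventually allI) (simp add: algebra_simps)
    show "(\<lambda>m. \<bar>t * (4 * ?b m - ?b (Suc m))\<bar>) \<longlonglongrightarrow> 0"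
      using tendsto_mult[OF tendsto_const[of t] beam_freq_lacunary_Suc] by (intro tendsto_rabs_zero) simp
  qed
  from tendsto_diff[OF 4 this] have "(\<lambda>m. cos (t * ?b (Suc m))) \<longlonglongrightarrow> 1" by simp
  moreover have "(\<lambda>m. cos (t * ?b (Suc m))) \<longlonglongrightarrow> 0" using c by (rule LIMSEQ_Suc)
  ultimately show False using LIMSEQ_unique by fastforce
qed

text \<open>On the support $|k| = 2^m$, so the coefficient at $\pm k_m$ is $2^{-m}$; reflected frequencies
are included to obtain a real distribution.\<close>

definition lacunary_coeff :: "int^3 \<Rightarrow> complex" where
  "lacunary_coeff k = (if k \<in> range lacunary \<union> uminus ` range lacunary then of_real (1 / norm (freq k)) else 0)"

lemma lacunary_coeff_reflect: "lacunary_coeff (- k) = cnj (lacunary_coeff k)"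
proof -
  have "- k \<in> range lacunary \<union> uminus ` range lacunary \<longleftrightarrow> k \<in> range lacunary \<union> uminus ` range lacunary"
    by (auto simp: image_iff) (metis minus_minus)+
  then show ?thesis by (simp add: lacunary_coeff_def freq_uminus)
qed

lemma lacunary_coeff_lacunary: "lacunary_coeff (lacunary m) = of_real (1 / 2 ^ m)"
  by (simp add: lacunary_coeff_def norm_freq_lacunary)

text \<open>Along the sequence the terms are of order $2^{\beta m - m}$. With $\beta = 0$ this makes the
Fourier series absolutely convergent, with $\beta = \alpha$ it places the sum in $X^\alpha$.\<close>

lemma lacunary_coeff_summable:
  assumes "\<beta> \<le> 1 / 2"
  shows "(\<integral>\<^sup>+k. ennreal (japanese \<beta> k * cmod (lacunary_coeff k)) \<partial>count_space UNIV) < \<infinity>"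
proof -
  let ?g = "\<lambda>k. ennreal (japanese \<beta> k * cmod (lacunary_coeff k))"
  have bd: "japanese \<beta> (lacunary m) * cmod (lacunary_coeff (lacunary m)) \<le> sqrt 2 * (1 / sqrt 2) ^ m" for m
  proof -
    let ?s = "sqrt 2 * sqrt 2 ^ m"
    have root: "sqrt 2 ^ 4 = (4 :: real)" by (simp add: power4_eq_xxxx)
    have pow: "((2 :: real) ^ m)\<^sup>2 = 4 ^ m" "(sqrt 2 ^ m) ^ 4 = 4 ^ m" "(sqrt 2) ^ 4 = 4"
      by (simp_all add: power_power_swap[of _ m] root)
    have "japanese \<beta> (lacunary m) = (1 + 4 ^ m) powr (\<beta> / 2)"
      by (simp add: japanese_def norm_freq_lacunary pow)
    also have "\<dots> \<le> (1 + 4 ^ m) powr (1 / 4)" using assms by (intro powr_mono) auto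
    also have "\<dots> \<le> (?s ^ 4) powr (1 / 4)"
    proof (rule powr_mono2)
      have "(1 :: real) \<le> 4 ^ m" by simp
      then show "1 + 4 ^ m \<le> ?s ^ 4" unfolding power_mult_distrib pow by linarith
    qed (auto simp: add_nonneg_nonneg)
    also have "\<dots> = ?s" by (simp add: powr_powr flip: powr_numeral)
    finally have "japanese \<beta> (lacunary m) * cmod (lacunary_coeff (lacunary m)) \<le> ?s * (1 / 2 ^ m)"
      by (simp add: lacunary_coeff_lacunary norm_divide norm_power divide_right_mono)
    also have "(2 :: real) ^ m = sqrt 2 ^ m * sqrt 2 ^ m" by (simp flip: power_mult_distrib)
    finally show ?thesis by (simp add: power_one_over field_simps)
  qed
  have sm: "summable (\<lambda>m. sqrt 2 * (1 / sqrt 2) ^ m)" by (intro summable_mult summable_geometric) simp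
  have half: "(\<integral>\<^sup>+k. ?g k \<partial>count_space (h ` range lacunary)) < \<infinity>"
    if "inj h" "\<And>k. ?g (h k) = ?g k" for h :: "int^3 \<Rightarrow> int^3"
  proof -
    have "bij_betw (h \<circ> lacunary) UNIV (h ` range lacunary)"
      using inj_compose[OF that(1) inj_lacunary] by (auto simp: bij_betw_def image_comp)
    from nn_integral_bij_count_space[OF this, of ?g, symmetric]
    have "(\<integral>\<^sup>+k. ?g k \<partial>count_space (h ` range lacunary)) = (\<Sum>m. ?g (lacunary m))"
      by (simp add: that(2) nn_integral_count_space_nat)
    also have "\<dots> \<le> (\<Sum>m. ennreal (sqrt 2 * (1 / sqrt 2) ^ m))"
      using bd by (intro suminf_le ennreal_leI) auto
    also have "\<dots> = ennreal (\<Sum>m. sqrt 2 * (1 / sqrt 2) ^ m)"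
      by (rule suminf_ennreal2[OF _ sm]) simp
    finally show ?thesis by (simp add: le_less_trans)
  qed
  have "(\<integral>\<^sup>+k. ?g k \<partial>count_space UNIV)
      \<le> (\<integral>\<^sup>+k. ?g k * indicator (range lacunary) k + ?g k * indicator (uminus ` range lacunary) k \<partial>count_space UNIV)"
    by (intro nn_integral_mono) (auto simp: lacunary_coeff_def indicator_def)
  also have "\<dots> = (\<integral>\<^sup>+k. ?g k * indicator (range lacunary) k \<partial>count_space UNIV) +
     (\<integral>\<^sup>+k. ?g k * indicator (uminus ` range lacunary) k \<partial>count_space UNIV)"
    by (rule nn_integral_add) auto
  also have "\<dots> = (\<integral>\<^sup>+k. ?g k \<partial>count_space (range lacunary)) + (\<integral>\<^sup>+k. ?g k \<partial>count_space (uminus ` range lacunary))"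
    by (simp add: nn_integral_count_space_indicator)
  also have "\<dots> < \<infinity>"
    using half[of id] half[of uminus] by (simp add: japanese_reflect lacunary_coeff_reflect)
  finally show ?thesis .
qed

lemma exists_non_decaying:
  assumes "\<alpha> < 1 / 2"
  shows "\<exists>w\<in>X_space \<alpha>. \<not> decaying (fst (S t w))"
proof -
  have j0: "japanese 0 k = 1" for k
    using add_pos_nonneg[of 1 "(norm (freq k))\<^sup>2"] by (simp add: japanese_def)
  have "integrable (count_space UNIV) lacunary_coeff"
    using lacunary_coeff_summable[of 0] by (intro integrableI_bounded) (simp_all add: j0)
  from Wiener_algebra_function[OF this lacunary_coeff_reflect]
  obtain f where f: "f \<in> borel_measurable torus"
    "\<And>x. \<bar>f x\<bar> \<le> (\<integral>k. cmod (lacunary_coeff k) \<partial>count_space UNIV)" "\<And>k. fcoeff f k = lacunary_coeff k"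
    by blast
  define w :: dpair where "w = (dist_of f, 0)"
  have "dist_of f \<in> distributions" by (rule dist_of_distributions[OF f(1,2)])
  then have d: "w \<in> distributions \<times> distributions"
    using distributions_diff[of "dist_of f" "dist_of f"] by (simp add: w_def)
  have co: "dcoeff (fst w) k = lacunary_coeff k" "dcoeff (snd w) k = 0" for k
    using dcoeff_dist_of[OF f(1,2)] f(3) by (simp_all add: w_def dcoeff_zero)
  have "wiener_norm \<alpha> w < \<top>"
    using lacunary_coeff_summable[of \<alpha>] assms by (simp add: wiener_norm_def coeff_weight_def co)
  then have "w \<in> X_space \<alpha>" by (rule wiener_norm_imp_X_space[OF d])
  moreover have "2 ^ m * Re (dcoeff (fst (S t w)) (lacunary m)) = s11 t (lacunary m)" for m
    by (simp add: dcoeff_S[OF d] co lacunary_coeff_lacunary)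
  then have "\<not> decaying (fst (S t w))" using s11_lacunary_not_null by (simp add: decaying_def)
  ultimately show ?thesis by blast
qed

section \<open>Discontinuity\<close>

text \<open>A decaying datum is perturbed by the difference of a non-decaying one and a close trigonometric
polynomial; a non-decaying datum is replaced by a close trigonometric polynomial.\<close>

lemma decaying_both_dense:
  assumes "\<alpha> < 1 / 2" and u: "u \<in> X_space \<alpha>" and \<epsilon>: "\<epsilon> > 0"
  shows "\<exists>v\<in>X_space \<alpha>. X_norm \<alpha> (v - u) < \<epsilon> \<and> decaying (fst (S t v)) \<noteq> decaying (fst (S t u))"
proof (cases "decaying (fst (S t u))")
  case True
  obtain w where w: "w \<in> X_space \<alpha>" "\<not> decaying (fst (S t w))" using exists_non_decaying[OF assms(1)] by blast
  then obtain p where p: "p \<in> trig_polys \<times> trig_polys" "X_norm \<alpha> (w - p) < \<epsilon>"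
    using \<epsilon> unfolding X_space_def by blast
  let ?v = "u - (p - w)"
  have "?v \<in> X_space \<alpha>" using u w(1) trig_polys_X_space[OF p(1)] by (intro X_space_diff)
  moreover have "?v - u = w - p" by simp
  moreover have "\<not> decaying (fst (S t ?v))"
  proof
    assume "decaying (fst (S t ?v))"
    then have "decaying (fst (S t u) - fst (S t ?v))" using True by (intro decaying_diff)
    then have "decaying (fst (S t p) - fst (S t w))" by (simp add: S_diff)
    then have "decaying (fst (S t p) - (fst (S t p) - fst (S t w)))"
      by (rule decaying_diff[OF decaying_S_trig_poly[OF p(1)]])
    then show False using w(2) by simp
  qed
  ultimately show ?thesis using True p(2) by (intro bexI[of _ ?v]) simp_all
next
  case False
  obtain p where p: "p \<in> trig_polys \<times> trig_polys" "X_norm \<alpha> (u - p) < \<epsilon>"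
    using u \<epsilon> unfolding X_space_def by blast
  have "(0 :: dpair) \<in> distributions \<times> distributions"
    using X_space_distributions[OF X_space_diff[OF u u]] by simp
  from X_norm_le_wiener_norm[OF this, of \<alpha>] have "X_norm \<alpha> 0 = 0"
    by (simp add: wiener_norm_def coeff_weight_def dcoeff_zero)
  then have "X_norm \<alpha> (p - u) \<le> X_norm \<alpha> (u - p)" using X_norm_diff[of \<alpha> 0 "u - p"] by simp
  then have "X_norm \<alpha> (p - u) < \<epsilon>" using p(2) by simp
  then show ?thesis using False trig_polys_X_space[OF p(1)] decaying_S_trig_poly[OF p(1)] by blast
qed

theorem mainTheorem2:
  fixes \<alpha> :: real
    and M :: "'w measure"
    and \<xi> :: "(real \<times> (real^3) \<Rightarrow> real) \<Rightarrow> 'w \<Rightarrow> real"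
    and \<theta> :: "real \<Rightarrow> 'w \<Rightarrow> dpair"
  assumes "0 < \<alpha>" and "\<alpha> < 1 / 2"
    and "white_noise M \<xi>"
    and "stochastic_convolution M \<xi> \<theta>"
  shows "\<not> strong_feller \<alpha> M \<theta> \<and>
    (\<forall>t>0. \<exists>G\<in>bounded_measurable \<alpha>. \<forall>u\<in>X_space \<alpha>.
       \<not> topcontinuous_at (X_top \<alpha>) euclideanreal (transition M \<theta> t G) u)"
proof -
  let ?G = "\<lambda>u :: dpair. of_bool (decaying (fst u)) :: real"
  have disc: "\<not> topcontinuous_at (X_top \<alpha>) euclideanreal (transition M \<theta> t ?G) u"
    if t: "t > 0" and u: "u \<in> X_space \<alpha>" for t u
  proof
    let ?T = "transition M \<theta> t ?G"
    have T: "?T v = of_bool (decaying (fst (S t v)))" for v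
      using transition_decaying[OF assms(3,4)] t by simp
    assume "topcontinuous_at (X_top \<alpha>) euclideanreal ?T u"
    \<comment> \<open>The values are 0 and 1, so a neighbourhood of radius 1 forces equality.\<close>
    then have "\<exists>U. openin (X_top \<alpha>) U \<and> u \<in> U \<and> (\<forall>y\<in>U. ?T y \<in> ball (?T u) 1)"
      unfolding topcontinuous_at_def by (metis centre_in_ball open_ball open_openin zero_less_one)
    then obtain U where U: "openin (X_top \<alpha>) U" "u \<in> U" "\<And>y. y \<in> U \<Longrightarrow> ?T y \<in> ball (?T u) 1" by blast
    obtain \<epsilon> where \<epsilon>: "\<epsilon> > 0" "\<And>w. w \<in> X_space \<alpha> \<Longrightarrow> X_norm \<alpha> (w - u) < \<epsilon> \<Longrightarrow> w \<in> U"
      using U(1,2) unfolding openin_X_top by blast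
    obtain v where "v \<in> X_space \<alpha>" "X_norm \<alpha> (v - u) < \<epsilon>" "decaying (fst (S t v)) \<noteq> decaying (fst (S t u))"
      using decaying_both_dense[OF assms(2) u \<epsilon>(1)] by blast
    then have "?T v \<in> ball (?T u) 1" "decaying (fst (S t v)) \<noteq> decaying (fst (S t u))"
      using \<epsilon>(2) U(3) by blast+
    then show False unfolding T by (auto simp: dist_real_def)
  qed
  obtain w where w: "w \<in> X_space \<alpha>" using exists_non_decaying[OF assms(2)] by blast
  have "\<not> strong_feller \<alpha> M \<theta>"
  proof
    assume "strong_feller \<alpha> M \<theta>"
    then have "continuous_map (X_top \<alpha>) euclideanreal (transition M \<theta> 1 ?G)"
      using decaying_bounded_measurable unfolding strong_feller_def by simp
    then show False
      using disc[of 1 w] w unfolding continuous_map_eq_topcontinuous_at topspace_X_top by simp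
  qed
  then show ?thesis using disc decaying_bounded_measurable by blast
qed

end
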